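(* Let $G$ be a finite triangle-free planar graph, and let $L$ be a 7-assignment for $G$. If $\alpha$ and $\beta$ are $L$-colorings of $G$, then $\alpha$ can be transformed to $\beta$ by an $L$-recoloring sequence in which each vertex is recolored at most 30 times (so that every intermediate coloring is a proper $L$-coloring).
   Context: A list-assignment $L$ for a graph $G$ assigns to each vertex $v$ a set $L(v)$ of colors; $L$ is a $k$-assignment if $|L(v)|=k$ for every vertex $v$. An $L$-coloring is a proper coloring $\varphi$ of $G$ with $\varphi(v)\in L(v)$ for all $v$. An $L$-recoloring step changes the color of a single vertex so that the resulting coloring is again a proper $L$-coloring. An $L$-recoloring sequence consists of an initial $L$-coloring followed by a sequence of $L$-recoloring steps; it transforms $\alpha$ to $\beta$ if its initial coloring is $\alpha$ and its final coloring is $\beta$. *)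

theory Defs
  imports "HOL-Analysis.Analysis" "Graph_Theory.Pair_Digraph"
begin

text \<open>
  Finite simple graphs are the locale \<open>pair_graph\<close> (finite, symmetric, loop-free, no parallel arcs):
  an edge between \<open>u\<close> and \<open>v\<close> is the pair of opposite arcs \<open>(u, v)\<close> and \<open>(v, u)\<close>.
\<close>

definition triangle_free :: "'a pair_pre_digraph \<Rightarrow> bool" where
  "triangle_free G \<longleftrightarrow>
     \<not> (\<exists>u v w. (u, v) \<in> parcs G \<and> (v, w) \<in> parcs G \<and> (w, u) \<in> parcs G)"

text \<open>
  A plane drawing, with the complex plane as the Euclidean plane. Every undirected edge \<open>{u, v}\<close> is
  drawn as one simple arc \<open>\<gamma> {u, v}\<close>, oriented either way, joining the points of its ends and
  passing through no other vertex; two distinct edges meet at most in the points of their common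
  ends.
\<close>

definition plane_drawing ::
    "'a pair_pre_digraph \<Rightarrow> ('a \<Rightarrow> complex) \<Rightarrow> ('a set \<Rightarrow> real \<Rightarrow> complex) \<Rightarrow> bool" where
  "plane_drawing G p \<gamma> \<longleftrightarrow>
     inj_on p (pverts G) \<and>
     (\<forall>u v. (u, v) \<in> parcs G \<longrightarrow>
        arc (\<gamma> {u, v}) \<and>
        {pathstart (\<gamma> {u, v}), pathfinish (\<gamma> {u, v})} = {p u, p v} \<and>
        path_image (\<gamma> {u, v}) \<inter> p ` pverts G = {p u, p v}) \<and>
     (\<forall>u v x y. (u, v) \<in> parcs G \<longrightarrow> (x, y) \<in> parcs G \<longrightarrow> {u, v} \<noteq> {x, y} \<longrightarrow>
        path_image (\<gamma> {u, v}) \<inter> path_image (\<gamma> {x, y}) \<subseteq> p ` ({u, v} \<inter> {x, y}))"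

definition planar :: "'a pair_pre_digraph \<Rightarrow> bool" where
  "planar G \<longleftrightarrow> (\<exists>p \<gamma>. plane_drawing G p \<gamma>)"

definition k_assignment :: "'a pair_pre_digraph \<Rightarrow> nat \<Rightarrow> ('a \<Rightarrow> 'c set) \<Rightarrow> bool" where
  "k_assignment G k L \<longleftrightarrow> (\<forall>v \<in> pverts G. finite (L v) \<and> card (L v) = k)"

text \<open>
  Colorings are functions on the vertex set, encoded as extensional functions
  (\<open>undefined\<close> off the vertex set), so that equal colorings are equal functions.
\<close>

definition L_coloring :: "'a pair_pre_digraph \<Rightarrow> ('a \<Rightarrow> 'c set) \<Rightarrow> ('a \<Rightarrow> 'c) \<Rightarrow> bool" where
  "L_coloring G L \<phi> \<longleftrightarrow>
     \<phi> \<in> (\<Pi>\<^sub>E v \<in> pverts G. L v) \<and> (\<forall>u v. (u, v) \<in> parcs G \<longrightarrow> \<phi> u \<noteq> \<phi> v)"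

definition L_recoloring_step ::
    "'a pair_pre_digraph \<Rightarrow> ('a \<Rightarrow> 'c set) \<Rightarrow> ('a \<Rightarrow> 'c) \<Rightarrow> ('a \<Rightarrow> 'c) \<Rightarrow> bool" where
  "L_recoloring_step G L \<phi> \<psi> \<longleftrightarrow>
     L_coloring G L \<phi> \<and> L_coloring G L \<psi> \<and>
     (\<exists>v \<in> pverts G. \<exists>c. c \<noteq> \<phi> v \<and> \<psi> = \<phi>(v := c))"

definition L_recoloring_sequence ::
    "'a pair_pre_digraph \<Rightarrow> ('a \<Rightarrow> 'c set) \<Rightarrow> ('a \<Rightarrow> 'c) list \<Rightarrow> bool" where
  "L_recoloring_sequence G L \<sigma> \<longleftrightarrow>
     \<sigma> \<noteq> [] \<and> L_coloring G L (hd \<sigma>) \<and> successively (L_recoloring_step G L) \<sigma>"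

definition transforms :: "('a \<Rightarrow> 'c) list \<Rightarrow> ('a \<Rightarrow> 'c) \<Rightarrow> ('a \<Rightarrow> 'c) \<Rightarrow> bool" where
  "transforms \<sigma> \<alpha> \<beta> \<longleftrightarrow> hd \<sigma> = \<alpha> \<and> last \<sigma> = \<beta>"

definition times_recolored :: "('a \<Rightarrow> 'c) list \<Rightarrow> 'a \<Rightarrow> nat" where
  "times_recolored \<sigma> v = card {i. Suc i < length \<sigma> \<and> (\<sigma> ! i) v \<noteq> (\<sigma> ! Suc i) v}"

end

theory Submission
  imports Defs
begin

text \<open>
  The sequence is built by induction on the vertex set: a set of vertices is deleted, the rest is
  recolored, and the deleted vertices are put back one by one. A vertex of degree \<open>d\<close> whose neighbours are
  recolored \<open>t\<close> times in total can be put back at the cost of \<open>\<lceil>t / (6 - d)\<rceil> + 1\<close> recolorings of its own, because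
  each of its new colours can be chosen to avoid the next \<open>6 - d\<close> conflicts. This stays within 30 for a
  vertex of degree at most 2, for two adjacent vertices of degree 3, and for a vertex \<open>x\<close> of degree at least 4
  of which all but at most two neighbours are light, where a vertex is light if it has degree 3, or has
  degree 4 and a neighbour of degree 3.

  A discharging argument shows that one of these configurations occurs in every nonempty triangle-free plane
  graph. It needs little about the faces of the drawing: an Euler inequality, that an edge
  bounds at most two faces, that the boundary of a face has no loose ends, and that two edges
  at a vertex of degree 3 have a face in common. These facts are derived for arbitrary arcs from the Jordan
  curve theorem and Janiszewski's theorem.
\<close>

section \<open>Crosscuts of plane sets\<close>

text \<open>The constants come from the obstacle that a vertex of degree 3 with all neighbours at
  the full budget costs \<open>90 / 3 + 1 = 31\<close>, one too many. It needs one cheaper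
  neighbour. A vertex with two neighbours present costs \<open>60 / 4 + 1 = 16\<close>; a vertex
  with three, one of them at 16, costs 76 / 3 rounded up plus 1, that is 27; and with one of them at
  27 it costs \<open>87 / 3 + 1 = 30\<close>. The chain 16, 27, 30 is what a light star realizes.
  The initial charges add up to at most -8 by the Euler inequality. Only upper bounds on this sum
  are needed, so a face may be measured by its set of boundary edges instead of a boundary walk,
  bridges may count once, and disconnected graphs need no separate treatment. Faces are bounded from
  below by counting distinct vertices on them: the boundary has minimum degree 2, hence at least as
  many edges as vertices. No cyclic order of edges at a vertex enters.\<close>

text \<open>An arc alone separates no two points of the plane, so Janiszewski's theorem applies as
  soon as it meets \<open>Y\<close> in a connected set.\<close>

lemma connected_component_avoiding_arc:
  fixes Y :: "complex set"
  assumes "closed Y" "arc g" "connected (path_image g \<inter> Y)"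
    and "connected_component (- Y) p q" "p \<notin> path_image g" "q \<notin> path_image g"
  shows "connected_component (- (Y \<union> path_image g)) p q"
proof -
  have "connected (- path_image g)"
    using connected_arc_complement[OF assms(2)] by simp
  hence "connected_component (- path_image g) p q"
    using assms(5,6) by (simp add: connected_iff_connected_component)
  from Janiszewski[OF compact_arc_image[OF assms(2)] assms(1,3) this assms(4)]
  show ?thesis by (simp add: Un_commute)
qed

text \<open>A disc minus a point is connected, an interval minus an inner point is not. The inverse
  of the arc would send a disc to a connected set of reals with three points, and removing the
  middle one is the contradiction.\<close>

lemma interior_arc_image_empty:
  fixes g :: "real \<Rightarrow> complex"
  assumes "arc g"
  shows "interior (path_image g) = {}"
proof (rule ccontr)
  assume "interior (path_image g) \<noteq> {}"
  then obtain m r where r: "r > 0" "ball m r \<subseteq> path_image g"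
    by (metis all_not_in_conv mem_interior)
  obtain h where h: "homeomorphism (path_image g) {0..1::real} h g"
    using homeomorphism_arc[OF assms] homeomorphism_symD by metis
  have conth: "continuous_on (path_image g) h" and gh: "\<And>x. x \<in> path_image g \<Longrightarrow> g (h x) = x"
    using h by (auto simp: homeomorphism_def)
  have injh: "inj_on h (path_image g)" using gh by (metis inj_onI)
  have conn: "connected (h ` (ball m r - F))" if "finite F" for F
    by (rule connected_continuous_image[OF continuous_on_subset[OF conth]])
       (use r that in \<open>auto intro!: connected_open_delete_finite\<close>)
  have "infinite (ball m r)" using uncountable_ball[OF r(1), of m] countable_finite by blast
  hence "infinite (h ` ball m r)"
    using finite_imageD inj_on_subset[OF injh r(2)] by blast
  then obtain T where T: "T \<subseteq> h ` ball m r" "card T = 3" "finite T"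
    using infinite_arbitrarily_large by blast
  have "\<exists>a b c. a \<in> T \<and> b \<in> T \<and> c \<in> T \<and> a < b \<and> b < c"
  proof -
    have "T \<noteq> {}" using T(2) by auto
    hence M: "Min T \<in> T" "Max T \<in> T" using T(3) by auto
    have "card {Min T, Max T} < card T" using T(2) card_insert_le_m1[of 2 "{Max T}" "Min T"] by simp
    hence "\<not> T \<subseteq> {Min T, Max T}" using card_mono[of "{Min T, Max T}" T] by auto
    then obtain b where b: "b \<in> T" "b \<noteq> Min T" "b \<noteq> Max T" by auto
    hence "Min T < b" "b < Max T" using T(3) by (simp_all add: order_less_le)
    thus ?thesis using M b(1) by blast
  qed
  then obtain a b c where abc: "a \<in> T" "b \<in> T" "c \<in> T" "a < b" "b < c" by blast
  have "a \<in> h ` ball m r" "b \<in> h ` ball m r" "c \<in> h ` ball m r" using abc T(1) by auto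
  then obtain x y z where xyz: "x \<in> ball m r" "y \<in> ball m r" "z \<in> ball m r"
    "a = h x" "b = h y" "c = h z" by (elim imageE)
  have "x \<noteq> y" "z \<noteq> y" using xyz abc by auto
  hence "a \<in> h ` (ball m r - {y})" "c \<in> h ` (ball m r - {y})"
    unfolding xyz(4,6) using xyz(1,3) by (intro imageI; simp)+
  moreover have "connected (h ` (ball m r - {y}))" by (rule conn) simp
  ultimately have "b \<in> h ` (ball m r - {y})"
    using abc(4,5) unfolding connected_iff_interval by (meson less_imp_le)
  then obtain y' where y': "y' \<in> ball m r" "y' \<noteq> y" "h y' = h y" unfolding xyz(5) by force
  have "y' \<in> path_image g" "y \<in> path_image g" using y'(1) xyz(2) r(2) by blast+
  thus False using y' inj_onD[OF injh] by blast
qed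

lemma open_arc_in_component:
  fixes X :: "complex set"
  assumes "arc g" "path_image g \<inter> X = {pathstart g, pathfinish g}"
  obtains U where "U \<in> components (- X)" "path_image g - X \<subseteq> U" "path_image g - X \<noteq> {}"
proof -
  have eq: "path_image g - X = path_image g - {pathstart g, pathfinish g}"
    using assms(2) by blast
  have sp: "simple_path g" using assms(1) by (rule arc_imp_simple_path)
  have c: "connected (path_image g - X)" "path_image g - X \<noteq> {}"
    unfolding eq using connected_simple_path_endless[OF sp] nonempty_simple_path_endless[OF sp] by auto
  hence "\<exists>U. U \<in> components (- X) \<and> path_image g - X \<subseteq> U"
    by (intro exists_component_superset) auto
  thus ?thesis using that c(2) by blast
qed

text \<open>Disjoint nonempty connected open sets filling a set are its components, and the
  components other than \<open>U\<close> are untouched by \<open>A\<close>.\<close>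

lemma components_split:
  fixes X :: "complex set"
  assumes "closed X" "closed (X \<union> A)" "U \<in> components (- X)" "A - X \<subseteq> U" "\<Union>\<P> = U - A"
    "pairwise disjnt \<P>" "\<And>P. P \<in> \<P> \<Longrightarrow> open P \<and> connected P \<and> P \<noteq> {}"
  shows "components (- (X \<union> A)) = (components (- X) - {U}) \<union> \<P>"
proof (rule components_open_unique)
  have "open (- X)" using assms(1) by auto
  show "pairwise disjnt (components (- X) - {U} \<union> \<P>)"
  proof -
    have "disjnt P Q" if "P \<in> components (- X) - {U}" "Q \<in> \<P>" for P Q
    proof -
      have "P \<inter> U = {}" using that(1) assms(3) components_nonoverlap by blast
      moreover have "Q \<subseteq> U" using assms(5) that(2) by blast
      ultimately show ?thesis by (auto simp: disjnt_def)
    qed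
    moreover have "disjnt P Q" if "P \<in> components (- X)" "Q \<in> components (- X)" "P \<noteq> Q" for P Q
      using components_nonoverlap[OF that(1,2)] that(3) by (simp add: disjnt_def)
    ultimately show ?thesis using assms(6) unfolding pairwise_def
      by (metis UnE DiffD1 disjnt_sym)
  qed
  show "\<Union> (components (- X) - {U} \<union> \<P>) = - (X \<union> A)"
  proof -
    have "\<Union> (components (- X)) = - X" by (rule Union_components)
    moreover have "\<Union> (components (- X) - {U}) \<inter> U = {}"
      using assms(3) components_nonoverlap by fastforce
    moreover have "\<Union> (components (- X)) = U \<union> \<Union> (components (- X) - {U})" using assms(3) by blast
    ultimately have "\<Union> (components (- X) - {U}) = - X - U" by blast
    thus ?thesis using assms(3,4,5) in_components_subset[OF assms(3)] by auto
  qed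
  fix P assume "P \<in> components (- X) - {U} \<union> \<P>"
  thus "open P \<and> connected P \<and> P \<noteq> {}"
    using assms(7) open_components[OF \<open>open (- X)\<close>] in_components_connected in_components_nonempty
    by blast
qed

text \<open>
  If the ends of the crosscut are joined by an arc inside \<open>X\<close>, the two arcs form a Jordan curve \<open>J\<close>
  with \<open>J \<inter> X\<close> an arc, hence connected. Janiszewski's theorem then shows that \<open>U \<inter> inside J\<close> and
  \<open>U \<inter> outside J\<close> are connected.
\<close>

lemma joined_crosscut:
  fixes X :: "complex set"
  assumes X: "closed X" and g: "arc g" and gX: "path_image g \<inter> X = {pathstart g, pathfinish g}"
    and joined: "path_component X (pathstart g) (pathfinish g)"
  obtains U P Q where "U \<in> components (- X)" "path_image g - X \<subseteq> U" "P \<noteq> Q"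
    "components (- (X \<union> path_image g)) = (components (- X) - {U}) \<union> {P, Q}"
    "P \<notin> components (- X)" "Q \<notin> components (- X)"
    "path_image g - X \<subseteq> closure P" "path_image g - X \<subseteq> closure Q"
proof -
  define A where "A = path_image g"
  obtain U where U: "U \<in> components (- X)" "A - X \<subseteq> U" "A - X \<noteq> {}"
    using open_arc_in_component[OF g gX] unfolding A_def by metis
  have ne: "pathstart g \<noteq> pathfinish g" using arc_distinct_ends[OF g] by auto
  obtain h0 where h0: "path h0" "path_image h0 \<subseteq> X" "pathstart h0 = pathfinish g" "pathfinish h0 = pathstart g"
    using joined path_component_sym unfolding path_component_def by metis
  obtain h where h: "arc h" "path_image h \<subseteq> X" "pathstart h = pathfinish g" "pathfinish h = pathstart g"
    by (metis path_contains_arc[OF h0(1,3,4)] ne h0(2) order_trans)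
  define c where "c = g +++ h"
  define J where "J = path_image c"
  have ends: "pathstart g \<in> path_image h" "pathfinish g \<in> path_image h"
    using h by (metis pathfinish_in_path_image pathstart_in_path_image)+
  have J: "J = A \<union> path_image h"
    unfolding J_def c_def A_def using h by (simp add: path_image_join)
  have sc: "simple_path c" unfolding c_def
    by (rule simple_path_join_loop) (use g h gX in auto)
  have lc: "pathfinish c = pathstart c" unfolding c_def using h by simp
  note Jordan = Jordan_inside_outside[OF sc lc, folded J_def]
  have JX: "J \<inter> X = path_image h"
  proof -
    have "A \<inter> X \<subseteq> path_image h" using gX ends unfolding A_def by simp
    thus ?thesis using J h(2) by blast
  qed
  have XJ: "J \<union> X = X \<union> A" using J h(2) by auto
  have cJ: "compact J" unfolding J_def using sc by (simp add: compact_simple_path_image)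
  have opU: "open U" using U(1) X open_components by blast
  have conU: "connected U" and UX: "U \<subseteq> - X" using in_components_connected[OF U(1)] in_components_subset[OF U(1)] by auto
  have AU: "A - X \<subseteq> U" by fact
  have key: "connected (U \<inter> I)" if I: "connected I" "I \<subseteq> - J"
    and Imax: "\<And>T. connected T \<Longrightarrow> T \<subseteq> - J \<Longrightarrow> T \<inter> I \<noteq> {} \<Longrightarrow> T \<subseteq> I" for I
    unfolding connected_iff_connected_component
  proof (intro ballI)
    fix p q assume p: "p \<in> U \<inter> I" and q: "q \<in> U \<inter> I"
    have "connected_component (- J) p q" using I p q unfolding connected_component_def by blast
    moreover have "connected_component (- X) p q" using conU UX p q unfolding connected_component_def by blast
    moreover have "connected (J \<inter> X)" using JX h(1) by (simp add: connected_arc_image)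
    ultimately have "connected_component (- (J \<union> X)) p q" by (intro Janiszewski[OF cJ X])
    then obtain T where T: "connected T" "T \<subseteq> - (J \<union> X)" "p \<in> T" "q \<in> T"
      unfolding connected_component_def by blast
    have "T \<subseteq> U" using components_maximal[OF U(1) T(1)] T p by blast
    moreover have "T \<subseteq> I" using Imax[OF T(1)] T p by blast
    ultimately show "connected_component (U \<inter> I) p q"
      unfolding connected_component_def using T by blast
  qed
  have sep: "inside J \<inter> outside J = {}" "inside J \<union> outside J = - J" by auto
  have opIO: "open (inside J)" "open (outside J)" using Jordan by auto
  have nosplit: "T \<subseteq> inside J \<or> T \<subseteq> outside J" if "connected T" "T \<subseteq> - J" for T
  proof -
    have "inside J \<inter> outside J \<inter> T = {}" "T \<subseteq> inside J \<union> outside J" using sep that(2) by simp_all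
    hence "inside J \<inter> T = {} \<or> outside J \<inter> T = {}" by (rule connectedD[OF that(1) opIO])
    thus ?thesis using sep(2) that(2) by blast
  qed
  define P Q where "P = U \<inter> inside J" and "Q = U \<inter> outside J"
  have conP: "connected P" unfolding P_def
  proof (rule key)
    show "connected (inside J)" using Jordan by simp
    show "inside J \<subseteq> - J" by (rule disjoint_eq_subset_Compl[THEN iffD1, OF inside_no_overlap])
    fix T assume T: "connected T" "T \<subseteq> - J" "T \<inter> inside J \<noteq> {}"
    show "T \<subseteq> inside J" using nosplit[OF T(1,2)] T(3) sep(1) by blast
  qed
  have conQ: "connected Q" unfolding Q_def
  proof (rule key)
    show "connected (outside J)" using Jordan by simp
    show "outside J \<subseteq> - J" by (rule disjoint_eq_subset_Compl[THEN iffD1, OF outside_no_overlap])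
    fix T assume T: "connected T" "T \<subseteq> - J" "T \<inter> outside J \<noteq> {}"
    show "T \<subseteq> outside J" using nosplit[OF T(1,2)] T(3) sep(1) by blast
  qed
  have fr: "J \<subseteq> closure (inside J)" "J \<subseteq> closure (outside J)"
    using Jordan unfolding frontier_def by auto
  \<comment> \<open>The crosscut lies on \<open>J\<close>, the frontier of both sides, and in the
    open set \<open>U\<close>, so its points remain limits after intersecting with
    \<open>U\<close>.\<close>
  have clP: "A - X \<subseteq> closure P"
    unfolding P_def using open_Int_closure_subset[OF opU, of "inside J"] AU fr(1) J by blast
  have clQ: "A - X \<subseteq> closure Q"
    unfolding Q_def using open_Int_closure_subset[OF opU, of "outside J"] AU fr(2) J by blast
  have ne: "P \<noteq> {}" "Q \<noteq> {}" using clP clQ U(3) by auto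
  have un: "\<Union>{P,Q} = U - A"
  proof -
    have "U - J = U - A" using J h(2) UX by blast
    moreover have "U \<inter> inside J \<union> U \<inter> outside J = U - J"
      unfolding Int_Un_distrib[symmetric] sep(2) by (simp add: Diff_eq)
    ultimately show ?thesis unfolding P_def Q_def by simp
  qed
  have PQ: "P \<inter> Q = {}" unfolding P_def Q_def using sep(1) by blast
  have comp: "components (- (X \<union> A)) = (components (- X) - {U}) \<union> {P, Q}"
  proof (rule components_split[OF X _ U(1,2) un])
    show "closed (X \<union> A)" using X g unfolding A_def by (simp add: closed_Un closed_arc_image)
    show "pairwise disjnt {P, Q}" using PQ by (auto simp: pairwise_def disjnt_def)
    show "open R \<and> connected R \<and> R \<noteq> {}" if "R \<in> {P,Q}" for R
      using that conP conQ ne opU opIO unfolding P_def Q_def by auto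
  qed
  \<comment> \<open>Other old components miss \<open>U\<close>, and \<open>U\<close> itself contains
    points of the crosscut, so the pieces are new. This makes the later count of faces
    exact.\<close>
  have "A \<inter> U \<noteq> {}" using U by blast
  hence notc: "R \<notin> components (- X)" if "R \<subseteq> U - A" "R \<noteq> {}" for R
    using that U(1) components_nonoverlap by blast
  show ?thesis
  proof (rule that[of U P Q])
    show "P \<notin> components (- X)" "Q \<notin> components (- X)" using notc un ne by blast+
    show "P \<noteq> Q" using PQ ne by blast
  qed (use U comp clP clQ in \<open>auto simp: A_def\<close>)
qed

text \<open>
  Here Janiszewski's theorem is applied twice, first to \<open>X1\<close> and the arc, then to their union and \<open>X2\<close>;
  both intersections are single points.
\<close>

lemma bridging_crosscut:
  fixes X :: "complex set"
  assumes X1: "compact X1" and X2: "closed X2" and disj: "X1 \<inter> X2 = {}" and g: "arc g"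
    and gX: "path_image g \<inter> (X1 \<union> X2) = {pathstart g, pathfinish g}"
    and ends: "pathstart g \<in> X1" "pathfinish g \<in> X2"
    and XX: "X = X1 \<union> X2"
  obtains U P where "U \<in> components (- X)" "path_image g - X \<subseteq> U"
    "components (- (X \<union> path_image g)) = (components (- X) - {U}) \<union> {P}"
    "P \<notin> components (- X)" "path_image g - X \<subseteq> closure P"
proof -
  define A where "A = path_image g"
  have X: "closed X" unfolding XX using X1 X2 by (simp add: closed_Un compact_imp_closed)
  obtain U where U: "U \<in> components (- X)" "A - X \<subseteq> U" "A - X \<noteq> {}"
    using open_arc_in_component[OF g gX] unfolding A_def XX by metis
  have opU: "open U" using U(1) X open_components by blast
  have conU: "connected U" and UX: "U \<subseteq> - X" using in_components_connected[OF U(1)] in_components_subset[OF U(1)] by auto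
  have cA: "closed A" using g unfolding A_def by (rule closed_arc_image)
  have A1: "A \<inter> X1 = {pathstart g}" and A2: "(X1 \<union> A) \<inter> X2 = {pathfinish g}"
    using gX ends disj g unfolding A_def by (auto dest: arc_distinct_ends)
  have con: "connected (U - A)" unfolding connected_iff_connected_component
  proof (intro ballI)
    fix p q assume p: "p \<in> U - A" and q: "q \<in> U - A"
    have "connected_component (- X1) p q" "connected_component (- X2) p q"
      using conU UX p q unfolding connected_component_def XX by blast+
    moreover have "connected_component (- (X1 \<union> A)) p q"
      unfolding A_def
      by (rule connected_component_avoiding_arc[OF _ g])
         (use calculation p q A1 X1 in \<open>auto simp: A_def compact_imp_closed\<close>)
    moreover have "compact (X1 \<union> A)" using X1 g unfolding A_def by (simp add: compact_Un compact_arc_image)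
    ultimately have "connected_component (- ((X1 \<union> A) \<union> X2)) p q"
      by (intro Janiszewski[OF _ X2]) (simp_all add: A2)
    then obtain T where T: "connected T" "T \<subseteq> - (X \<union> A)" "p \<in> T" "q \<in> T"
      unfolding connected_component_def XX by blast
    have "T \<subseteq> U" using components_maximal[OF U(1) T(1)] T p by blast
    thus "connected_component (U - A) p q" unfolding connected_component_def using T by blast
  qed
  \<comment> \<open>A point of the crosscut that is no limit of \<open>U - A\<close> would have a
    neighbourhood inside the arc.\<close>
  have cl: "A - X \<subseteq> closure (U - A)"
  proof
    fix m assume m: "m \<in> A - X"
    show "m \<in> closure (U - A)"
    proof (rule ccontr)
      assume "m \<notin> closure (U - A)"
      define W where "W = U \<inter> - closure (U - A)"
      have "m \<in> U" using m U(2) by (rule subsetD[rotated])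
      hence "m \<in> W" unfolding W_def using \<open>m \<notin> closure (U - A)\<close> by simp
      have "open W" unfolding W_def by (intro open_Int opU open_Compl closed_closure)
      have "W \<subseteq> A"
      proof
        fix x assume "x \<in> W"
        hence "x \<in> U" "x \<notin> closure (U - A)" unfolding W_def by simp_all
        thus "x \<in> A" using closure_subset[of "U - A"] by (metis DiffI subsetD)
      qed
      have "m \<in> interior A" by (rule interiorI[OF \<open>open W\<close> \<open>m \<in> W\<close> \<open>W \<subseteq> A\<close>])
      thus False using interior_arc_image_empty[OF g] unfolding A_def by simp
    qed
  qed
  have ne: "U - A \<noteq> {}"
  proof
    assume "U - A = {}"
    hence "A - X \<subseteq> closure {}" using cl by (simp only:)
    thus False using U(3) by simp
  qed
  have comp: "components (- (X \<union> A)) = (components (- X) - {U}) \<union> {U - A}"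
    by (rule components_split[OF X _ U(1,2)])
       (use X cA con ne opU in \<open>auto simp: closed_Un open_Diff\<close>)
  have "A \<inter> U \<noteq> {}" using U by blast
  hence notc: "U - A \<notin> components (- X)"
    using ne U(1) components_nonoverlap by blast
  show ?thesis
    by (rule that[of U "U - A"]) (use U comp cl notc in \<open>auto simp: A_def\<close>)
qed

text \<open>Path components need not be closed in general. Here every piece lies inside the
  component or misses it, so the component and the rest are finite unions of closed pieces.\<close>

lemma closed_path_component_finite_Union:
  fixes X :: "'a::real_normed_vector set"
  assumes "finite \<C>" "\<And>C. C \<in> \<C> \<Longrightarrow> closed C \<and> path_connected C" "X = \<Union>\<C>"
  shows "closed (path_component_set X a)" "closed (X - path_component_set X a)"
proof -
  let ?K = "path_component_set X a"
  have dich: "C \<subseteq> ?K \<or> C \<inter> ?K = {}" if "C \<in> \<C>" for C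
  proof (cases "C \<inter> ?K = {}")
    case False
    then obtain z where z: "z \<in> C" "path_component X a z" by auto
    have "path_component X z y" if "y \<in> C" for y
    proof -
      have "path_component C z y"
        using assms(2)[OF \<open>C \<in> \<C>\<close>] z(1) that by (simp add: path_connected_component)
      thus ?thesis using assms(3) \<open>C \<in> \<C>\<close> by (meson Union_upper path_component_of_subset)
    qed
    thus ?thesis using z(2) path_component_trans by blast
  qed simp
  have sub: "?K \<subseteq> X" by (rule path_component_subset)
  have "?K = \<Union>{C \<in> \<C>. C \<subseteq> ?K}" using dich sub assms(3) by blast
  moreover have "closed (\<Union>{C \<in> \<C>. C \<subseteq> ?K})" using assms by (intro closed_Union) auto
  ultimately show "closed ?K" by simp
  have "X - ?K = \<Union>{C \<in> \<C>. C \<inter> ?K = {}}" using dich sub assms(3) by blast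
  moreover have "closed (\<Union>{C \<in> \<C>. C \<inter> ?K = {}})" using assms by (intro closed_Union) auto
  ultimately show "closed (X - ?K)" by simp
qed

section \<open>Faces of a plane drawing\<close>

locale plane_arcs =
  fixes V :: "complex set" and E :: "'e set" and g :: "'e \<Rightarrow> real \<Rightarrow> complex"
  assumes finV: "finite V" and finE: "finite E"
    and arc_g: "e \<in> E \<Longrightarrow> arc (g e)"
    and arc_verts: "e \<in> E \<Longrightarrow> path_image (g e) \<inter> V = {pathstart (g e), pathfinish (g e)}"
    and arc_cross: "e \<in> E \<Longrightarrow> e' \<in> E \<Longrightarrow> e \<noteq> e' \<Longrightarrow> path_image (g e) \<inter> path_image (g e') \<subseteq> V"
begin

text \<open>All of \<open>V\<close> is kept for every \<open>F\<close>, so that a new arc meets the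
  drawing in its two ends even if these were isolated before.\<close>

definition drawing :: "'e set \<Rightarrow> complex set" where
  "drawing F = V \<union> (\<Union>e\<in>F. path_image (g e))"

definition faces :: "'e set \<Rightarrow> complex set set" where
  "faces F = components (- drawing F)"

definition ends :: "'e \<Rightarrow> complex set" where
  "ends e = {pathstart (g e), pathfinish (g e)}"

text \<open>The points of \<open>V\<close> are excluded because a face can touch an arc at a vertex
  only.\<close>

definition bounds :: "'e \<Rightarrow> complex set \<Rightarrow> bool" where
  "bounds e C \<longleftrightarrow> (path_image (g e) - V) \<inter> closure C \<noteq> {}"

lemma ends_eq: "e \<in> E \<Longrightarrow> ends e = path_image (g e) \<inter> V"
  unfolding ends_def using arc_verts by blast

lemma other_end:
  assumes "e \<in> E" "w \<in> ends e"
  obtains a where "ends e = {w, a}" "a \<noteq> w"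
proof (cases "w = pathstart (g e)")
  case True
  show ?thesis
    by (rule that[of "pathfinish (g e)"])
       (use True arc_distinct_ends[OF arc_g[OF assms(1)]] in \<open>simp_all add: ends_def\<close>)
next
  case False
  hence "w = pathfinish (g e)" using assms(2) by (simp add: ends_def)
  thus ?thesis
    by (intro that[of "pathstart (g e)"]) (use False in \<open>auto simp: ends_def\<close>)
qed

lemma compact_drawing: assumes "F \<subseteq> E" shows "compact (drawing F)"
proof -
  have "finite F" using assms finE by (rule finite_subset)
  moreover have "compact (path_image (g e))" if "e \<in> F" for e
    using that assms arc_g by (auto intro: compact_arc_image)
  ultimately show ?thesis unfolding drawing_def using finV
    by (intro compact_Un[OF finite_imp_compact] compact_UN)
qed

lemma closed_drawing: "F \<subseteq> E \<Longrightarrow> closed (drawing F)"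
  using compact_drawing compact_imp_closed by blast

lemma drawing_insert: "drawing (insert e F) = drawing F \<union> path_image (g e)"
  unfolding drawing_def by auto

lemma arc_Int_drawing:
  assumes "F \<subseteq> E" "e \<in> E - F"
  shows "path_image (g e) \<inter> drawing F = {pathstart (g e), pathfinish (g e)}"
proof -
  have "path_image (g e) \<inter> path_image (g e') \<subseteq> V" if "e' \<in> F" for e'
    using arc_cross[of e e'] assms that by auto
  hence "path_image (g e) \<inter> drawing F = path_image (g e) \<inter> V"
    unfolding drawing_def by blast
  thus ?thesis using arc_verts assms(2) by auto
qed

lemma open_arc_drawing:
  assumes "F \<subseteq> E" "e \<in> E - F"
  shows "path_image (g e) - drawing F = path_image (g e) - V"
  using arc_Int_drawing[OF assms] arc_verts[of e] assms(2) by blast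

lemma open_arc:
  assumes "e \<in> E"
  shows "connected (path_image (g e) - V)" "path_image (g e) - V \<noteq> {}"
proof -
  have eq: "path_image (g e) - V = path_image (g e) - {pathstart (g e), pathfinish (g e)}"
    using arc_verts[OF assms] by blast
  have "simple_path (g e)" using arc_g[OF assms] by (rule arc_imp_simple_path)
  from connected_simple_path_endless[OF this] nonempty_simple_path_endless[OF this]
  show "connected (path_image (g e) - V)" "path_image (g e) - V \<noteq> {}" unfolding eq .
qed

lemma drawing_pieces:
  assumes "F \<subseteq> E" and "W \<subseteq> V"
  shows "closed (path_component_set (W \<union> (\<Union>e\<in>F. path_image (g e))) a)"
    "closed (W \<union> (\<Union>e\<in>F. path_image (g e)) - path_component_set (W \<union> (\<Union>e\<in>F. path_image (g e))) a)"
proof -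
  define \<C> where "\<C> = (\<lambda>v. {v}) ` W \<union> (\<lambda>e. path_image (g e)) ` F"
  have fin: "finite \<C>" unfolding \<C>_def using finV finE assms by (auto dest: finite_subset)
  have pieces: "closed C \<and> path_connected C" if "C \<in> \<C>" for C
    using that assms(1) arc_g unfolding \<C>_def
    by (auto intro!: closed_arc_image path_connected_path_image arc_imp_path)
  have un: "W \<union> (\<Union>e\<in>F. path_image (g e)) = \<Union>\<C>" unfolding \<C>_def by auto
  show "closed (path_component_set (W \<union> (\<Union>e\<in>F. path_image (g e))) a)"
    "closed (W \<union> (\<Union>e\<in>F. path_image (g e)) - path_component_set (W \<union> (\<Union>e\<in>F. path_image (g e))) a)"
    by (rule closed_path_component_finite_Union[OF fin pieces un]; assumption)+
qed

definition joined :: "'e set \<Rightarrow> 'e \<Rightarrow> bool" where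
  "joined F e \<longleftrightarrow> path_component (drawing F) (pathstart (g e)) (pathfinish (g e))"

text \<open>Serves two counts: that of all faces, for which the new faces must differ from the old
  ones, and that of the faces at one edge, for which they must be bounded by
  \<open>e\<close>.\<close>

lemma add_arc:
  assumes F: "F \<subseteq> E" and e: "e \<in> E - F"
  obtains U \<P> where "U \<in> faces F" "path_image (g e) - V \<subseteq> U" "finite \<P>"
    "faces (insert e F) = (faces F - {U}) \<union> \<P>" "\<P> \<inter> faces F = {}"
    "\<And>P. P \<in> \<P> \<Longrightarrow> bounds e P" "card \<P> = (if joined F e then 2 else 1)"
proof -
  let ?X = "drawing F" and ?A = "path_image (g e)"
  have g: "arc (g e)" using arc_g e by auto
  note AX = arc_Int_drawing[OF F e]
  have op: "?A - ?X = ?A - V" by (rule open_arc_drawing[OF F e])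
  have ne: "?A - V \<noteq> {}" using open_arc e by auto
  have bd: "bounds e P" if "?A - V \<subseteq> closure P" for P
    unfolding bounds_def using that ne by (metis Int_absorb2)
  show ?thesis
  proof (cases "joined F e")
    case True
    then obtain U P Q where *: "U \<in> components (- ?X)" "?A - ?X \<subseteq> U" "P \<noteq> Q"
      "components (- (?X \<union> ?A)) = (components (- ?X) - {U}) \<union> {P, Q}"
      "P \<notin> components (- ?X)" "Q \<notin> components (- ?X)" "?A - ?X \<subseteq> closure P" "?A - ?X \<subseteq> closure Q"
      using joined_crosscut[OF closed_drawing[OF F] g AX] unfolding joined_def by metis
    show ?thesis
      by (rule that[of U "{P,Q}"])
         (use * True bd in \<open>auto simp: faces_def drawing_insert op\<close>)
  next
    case False
    \<comment> \<open>The path component of one end and the rest of the drawing are the two disjoint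
      closed sets that the arc bridges.\<close>
    let ?K = "path_component_set ?X (pathstart (g e))"
    have cl: "closed ?K" "closed (?X - ?K)"
      using drawing_pieces[OF F order_refl] unfolding drawing_def by auto
    have sub: "?K \<subseteq> ?X" by (rule path_component_subset)
    have st: "pathstart (g e) \<in> ?X" "pathfinish (g e) \<in> ?X" using AX by auto
    have cK: "compact ?K"
      using compact_Int_closed[OF compact_drawing[OF F] cl(1)] sub by (simp add: Int_absorb1)
    have un: "?X = ?K \<union> (?X - ?K)" using sub by blast
    have AK: "?A \<inter> (?K \<union> (?X - ?K)) = {pathstart (g e), pathfinish (g e)}" using AX un by simp
    obtain U P where *: "U \<in> components (- ?X)" "?A - ?X \<subseteq> U"
      "components (- (?X \<union> ?A)) = (components (- ?X) - {U}) \<union> {P}"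
      "P \<notin> components (- ?X)" "?A - ?X \<subseteq> closure P"
    proof (rule bridging_crosscut[OF cK cl(2) _ g AK _ _ un])
      show "?K \<inter> (?X - ?K) = {}" by blast
      show "pathstart (g e) \<in> ?K" using st(1) by (simp add: path_component_refl)
      show "pathfinish (g e) \<in> ?X - ?K" using False st(2) unfolding joined_def by simp
    qed
    show ?thesis
      by (rule that[of U "{P}"])
         (use * False bd in \<open>auto simp: faces_def drawing_insert op\<close>)
  qed
qed

section \<open>Counting faces: the Euler inequality\<close>

lemma open_face: "F \<subseteq> E \<Longrightarrow> C \<in> faces F \<Longrightarrow> open C"
  unfolding faces_def using open_components closed_drawing by blast

lemma faces_empty: "faces {} = {- V}"
proof -
  have "connected (- V)"
    using connected_open_delete_finite[of UNIV V] finV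
    by (simp add: Compl_eq_Diff_UNIV connected_UNIV)
  moreover have "- V \<noteq> {}"
    using finV infinite_UNIV_char_0[where 'a=complex] by (metis Compl_UNIV_eq double_compl)
  ultimately show ?thesis unfolding faces_def drawing_def
    by (simp add: components_eq_sing_iff)
qed

lemma finite_faces: assumes "F \<subseteq> E" shows "finite (faces F)"
proof -
  have "finite F" using assms finE by (rule finite_subset)
  thus ?thesis using assms
  proof (induction F)
    case empty thus ?case by (simp add: faces_empty)
  next
    case (insert e F)
    from insert.prems insert.hyps have F: "F \<subseteq> E" "e \<in> E - F" by auto
    obtain U \<P> where "finite \<P>" "faces (insert e F) = (faces F - {U}) \<union> \<P>"
      by (metis add_arc[OF F])
    thus ?case using insert.IH[OF F(1)] by simp
  qed
qed

lemma card_faces_insert: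
  assumes F: "F \<subseteq> E" and e: "e \<in> E - F"
  shows "card (faces (insert e F)) = card (faces F) + (if joined F e then 1 else 0)"
proof -
  obtain U \<P> where *: "U \<in> faces F" "finite \<P>"
    "faces (insert e F) = (faces F - {U}) \<union> \<P>" "\<P> \<inter> faces F = {}"
    "card \<P> = (if joined F e then 2 else 1)"
    by (metis add_arc[OF F e])
  have "card (faces (insert e F)) = card (faces F - {U}) + card \<P>"
    unfolding *(3) using *(2,4) finite_faces[OF F] by (intro card_Un_disjoint) auto
  moreover have "card (faces F) = Suc (card (faces F - {U}))"
    using *(1) finite_faces[OF F] by (metis card.remove)
  ultimately show ?thesis using *(5) by auto
qed

text \<open>
  The labels \<open>r\<close> stand for the components of the graph: an arc between equal labels cuts a face
  into two, an arc between different labels merges two labels.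
\<close>

lemma faces_lower_bound_labelling:
  assumes "F \<subseteq> E"
  shows "\<exists>r :: complex \<Rightarrow> complex. (\<forall>u\<in>V. \<forall>v\<in>V. r u = r v \<longrightarrow> path_component (drawing F) u v) \<and>
    card (faces F) + card V \<ge> card F + 1 + card (r ` V)"
proof -
  have "finite F" using assms finE by (rule finite_subset)
  thus ?thesis using assms
  proof (induction F)
    case empty
    show ?case
      by (rule exI[of _ "\<lambda>v. v"]) (auto simp: faces_empty drawing_def path_component_refl)
  next
    case (insert e F)
    from insert.prems insert.hyps have F: "F \<subseteq> E" "e \<in> E - F" by auto
    from insert.IH[OF F(1)] obtain r :: "complex \<Rightarrow> complex"
      where r0: "\<forall>u\<in>V. \<forall>v\<in>V. r u = r v \<longrightarrow> path_component (drawing F) u v"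
      and c: "card (faces F) + card V \<ge> card F + 1 + card (r ` V)"
      by (elim exE conjE)
    have r: "path_component (drawing F) u v" if "u \<in> V" "v \<in> V" "r u = r v" for u v
      using r0 that by simp
    let ?a = "pathstart (g e)" and ?b = "pathfinish (g e)" and ?X = "drawing (insert e F)"
    have ab: "?a \<in> V" "?b \<in> V" using arc_verts[of e] F(2) by auto
    have mono: "path_component ?X u v" if "path_component (drawing F) u v" for u v
      using that by (rule path_component_of_subset[rotated]) (auto simp: drawing_insert)
    show ?case
    proof (cases "r ?a = r ?b")
      case True
      hence "joined F e" unfolding joined_def using r ab by blast
      hence "card (faces (insert e F)) = card (faces F) + 1"
        using card_faces_insert[OF F] by simp
      thus ?thesis using r c mono insert.hyps by (intro exI[of _ r]) auto
    next
      case False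
      define r' where "r' v = (if r v = r ?b then r ?a else r v)" for v
      have "path_component (path_image (g e)) ?a ?b"
        using arc_g F(2) by (metis DiffD1 arc_imp_path path_component_def order_refl)
      hence pab: "path_component ?X ?a ?b"
        by (rule path_component_of_subset[rotated]) (auto simp: drawing_insert)
      have "path_component ?X u v" if uv: "u \<in> V" "v \<in> V" "r' u = r' v" for u v
      proof -
        have key: "path_component ?X w ?a" if "w \<in> V" "r' w = r ?a" for w
        proof (cases "r w = r ?b")
          case True
          thus ?thesis using mono r[OF \<open>w \<in> V\<close> ab(2)] pab by (meson path_component_sym path_component_trans)
        next
          case False
          thus ?thesis using that mono r[OF \<open>w \<in> V\<close> ab(1)] unfolding r'_def by auto
        qed
        show ?thesis
        proof (cases "r' u = r ?a")
          case True
          thus ?thesis using key uv by (metis path_component_sym path_component_trans)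
        next
          case False
          hence "r u = r v" using uv(3) unfolding r'_def by (auto split: if_splits)
          thus ?thesis using r uv mono by blast
        qed
      qed
      moreover have "card (r' ` V) < card (r ` V)"
      proof (rule psubset_card_mono)
        show "finite (r ` V)" using finV by simp
        have "r ?b \<notin> r' ` V" using False unfolding r'_def by auto
        moreover have "r' ` V \<subseteq> r ` V" using ab unfolding r'_def by auto
        ultimately show "r' ` V \<subset> r ` V" using ab(2) by blast
      qed
      \<comment> \<open>Equal labels imply joined ends, but no converse is known. If ends with
        different labels happen to be joined, the extra face only improves the bound.\<close>
      moreover have "card (faces (insert e F)) \<ge> card (faces F)"
        using card_faces_insert[OF F] by simp
      ultimately show ?thesis using c insert.hyps by (intro exI[of _ r']) auto
    qed
  qed
qed

lemma Euler_lower_bound: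
  assumes "V \<noteq> {}" shows "card (faces E) + card V \<ge> card E + 2"
proof -
  obtain r :: "complex \<Rightarrow> complex" where r: "card (faces E) + card V \<ge> card E + 1 + card (r ` V)"
    using faces_lower_bound_labelling[OF order_refl] by blast
  have "card (r ` V) > 0" using assms finV by (simp add: card_gt_0_iff)
  thus ?thesis using r by simp
qed

section \<open>Boundary arcs of a face\<close>

text \<open>With \<open>e\<close> added last, the faces at \<open>e\<close> are exactly the new
  ones: an old face other than \<open>U\<close> stays away from the open set \<open>U\<close> that
  contains the inner points of \<open>e\<close>. The value is 1 precisely for bridges.\<close>

lemma card_bounded_faces:
  assumes e: "e \<in> E"
  shows "card {C \<in> faces E. bounds e C} = (if joined (E - {e}) e then 2 else 1)"
proof -
  have F: "E - {e} \<subseteq> E" "e \<in> E - (E - {e})" using e by auto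
  obtain U \<P> where *: "U \<in> faces (E - {e})" "path_image (g e) - V \<subseteq> U"
    "faces (insert e (E - {e})) = (faces (E - {e}) - {U}) \<union> \<P>"
    "\<And>P. P \<in> \<P> \<Longrightarrow> bounds e P" "card \<P> = (if joined (E - {e}) e then 2 else 1)"
    by (metis add_arc[OF F])
  have E: "insert e (E - {e}) = E" using e by auto
  have "\<not> bounds e C" if "C \<in> faces (E - {e}) - {U}" for C
  proof -
    have "C \<inter> U = {}" using that *(1) components_nonoverlap unfolding faces_def by blast
    hence "closure C \<inter> U = {}" using open_face[OF F(1) *(1)] by (simp add: open_Int_closure_eq_empty Int_commute)
    thus ?thesis unfolding bounds_def using *(2) by blast
  qed
  hence "{C \<in> faces E. bounds e C} = \<P>" using *(3,4) unfolding E by blast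
  thus ?thesis using *(5) by simp
qed

text \<open>Erasing the arcs that do not bound \<open>C\<close> does not enlarge \<open>C\<close>.
  Frontier points of \<open>C\<close> lie on the drawing and hence on \<open>drawing E0\<close>, so
  \<open>C\<close> is open and relatively closed in the connected face \<open>D\<close> around
  it.\<close>

lemma face_of_boundary:
  assumes C: "C \<in> faces E"
  shows "C \<in> faces {e \<in> E. bounds e C}"
proof -
  define E0 where "E0 = {e \<in> E. bounds e C}"
  have E0: "E0 \<subseteq> E" unfolding E0_def by auto
  have sub: "drawing E0 \<subseteq> drawing E" unfolding drawing_def using E0 by auto
  have Cc: "connected C" "C \<noteq> {}" "C \<subseteq> - drawing E"
    using C in_components_connected in_components_nonempty in_components_subset unfolding faces_def by blast+
  obtain D where D: "D \<in> faces E0" "C \<subseteq> D"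
    using exists_component_superset[of C "- drawing E0"] Cc sub unfolding faces_def by blast
  have cl: "closure C \<inter> D \<subseteq> C"
  proof
    fix z assume z: "z \<in> closure C \<inter> D"
    show "z \<in> C"
    proof (rule ccontr)
      assume "z \<notin> C"
      hence "z \<in> frontier C" using z by (auto simp: frontier_def interior_open[OF open_face[OF order_refl C]])
      hence "z \<in> drawing E"
        using frontier_of_components_closed_complement[OF closed_drawing[OF order_refl]] C
        unfolding faces_def by blast
      moreover have "z \<notin> drawing E0" using z D(1) in_components_subset unfolding faces_def by blast
      ultimately obtain e where "e \<in> E" "e \<notin> E0" "z \<in> path_image (g e) - V" unfolding drawing_def by auto
      thus False using z unfolding E0_def bounds_def by auto
    qed
  qed
  have "C = D"
  proof (rule ccontr)
    assume "C \<noteq> D"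
    have "connected D" using D(1) in_components_connected unfolding faces_def by blast
    moreover have "C \<inter> - closure C \<inter> D = {}" using closure_subset[of C] by auto
    moreover have "D \<subseteq> C \<union> - closure C" using cl by auto
    ultimately have "C \<inter> D = {} \<or> - closure C \<inter> D = {}"
      using open_face[OF order_refl C] by (intro connectedD) auto
    moreover have "C \<inter> D \<noteq> {}" using D(2) Cc(2) by auto
    ultimately have "D \<subseteq> closure C" by auto
    thus False using cl D(2) \<open>C \<noteq> D\<close> by auto
  qed
  thus ?thesis using D(1) unfolding E0_def by simp
qed

text \<open>A face without boundary arcs would be all of \<open>- V\<close>, which contains the
  inner points of every arc.\<close>

lemma face_has_boundary:
  assumes "C \<in> faces E" "E \<noteq> {}" shows "\<exists>e\<in>E. bounds e C"
proof (rule ccontr)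
  assume "\<not> (\<exists>e\<in>E. bounds e C)"
  hence "{e \<in> E. bounds e C} = {}" by auto
  hence "C = - V" using face_of_boundary[OF assms(1)] by (simp only: faces_empty singleton_iff)
  moreover obtain e where "e \<in> E" using assms(2) by auto
  ultimately have "path_image (g e) - V \<subseteq> C" "path_image (g e) - V \<subseteq> drawing E" "path_image (g e) - V \<noteq> {}"
    using open_arc unfolding drawing_def by auto
  thus False using assms(1) in_components_subset unfolding faces_def by blast
qed

lemma end_in_closure:
  assumes e: "e \<in> E" and w: "w \<in> ends e"
  shows "w \<in> closure (path_image (g e) - V)"
proof -
  have con: "connected (path_image (g e))" using arc_g[OF e] by (rule connected_arc_image)
  have w': "w \<in> path_image (g e)" using ends_eq[OF e] w by auto
  have "path_image (g e) \<noteq> {x}" for x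
    using arc_distinct_ends[OF arc_g[OF e]] by (metis pathfinish_in_path_image pathstart_in_path_image singletonD)
  hence "w islimpt path_image (g e)" using connected_imp_perfect[OF con w'] by blast
  moreover have "path_image (g e) = (path_image (g e) \<inter> V) \<union> (path_image (g e) - V)" by auto
  ultimately have "w islimpt path_image (g e) - V"
    using finV islimpt_Un_finite[of "path_image (g e) \<inter> V" w "path_image (g e) - V"] by auto
  thus ?thesis by (simp add: closure_def)
qed

text \<open>
  If \<open>e\<close> were the only boundary arc of \<open>C\<close> at \<open>w\<close>, it would be a pendant arc of the boundary. A pendant arc does not
  separate its neighbourhood, so \<open>C\<close> would contain points of \<open>e'\<close> near \<open>w\<close>.
\<close>

lemma boundary_continues:
  assumes C: "C \<in> faces E" and e: "e \<in> E" "bounds e C" and w: "w \<in> ends e"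
    and e': "e' \<in> E" "e' \<noteq> e" "w \<in> ends e'"
  shows "\<exists>e''\<in>E. e'' \<noteq> e \<and> w \<in> ends e'' \<and> bounds e'' C"
proof (rule ccontr)
  assume neg: "\<not> ?thesis"
  define E0 where "E0 = {e \<in> E. bounds e C}"
  define A where "A = path_image (g e)"
  \<comment> \<open>The boundary drawing without \<open>w\<close> and without \<open>e\<close>. By
    assumption no other boundary arc ends at \<open>w\<close>, so \<open>Y\<close> misses
    \<open>w\<close> and meets \<open>e\<close> only in its far end \<open>a\<close>.\<close>
  define Y where "Y = (V - {w}) \<union> (\<Union>f\<in>E0 - {e}. path_image (g f))"
  have E0: "E0 \<subseteq> E" "e \<in> E0" unfolding E0_def using e by auto
  have wV: "w \<in> V" "w \<in> A" unfolding A_def using ends_eq[OF e(1)] w by auto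
  have C0: "C \<in> components (- drawing E0)" using face_of_boundary[OF C] unfolding E0_def faces_def .
  have notw: "w \<notin> path_image (g f)" if "f \<in> E0 - {e}" for f
    using that neg ends_eq[of f] wV unfolding E0_def by auto
  have wY: "w \<notin> Y" unfolding Y_def using notw by auto
  have YA: "drawing E0 = Y \<union> A" unfolding drawing_def Y_def A_def using E0 wV(2) A_def by auto
  have clY: "closed Y" unfolding Y_def
    using finV finE E0 arc_g by (intro closed_Un closed_UN finite_imp_closed)
      (auto intro: closed_arc_image finite_subset)
  obtain a where a: "ends e = {w, a}" "a \<noteq> w" using other_end[OF e(1) w] .
  have AV: "A \<inter> V = {w, a}" using ends_eq[OF e(1)] a unfolding A_def by auto
  have Across: "A \<inter> path_image (g f) \<subseteq> V" if "f \<in> E" "f \<noteq> e" for f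
    unfolding A_def using arc_cross[of e f] e that by auto
  have AY: "A \<inter> Y = {a}"
  proof
    show "A \<inter> Y \<subseteq> {a}"
    proof
      fix z assume z: "z \<in> A \<inter> Y"
      have "z \<in> V" using z Across E0 unfolding Y_def by blast
      thus "z \<in> {a}" using z AV wY by auto
    qed
    show "{a} \<subseteq> A \<inter> Y" using AV a(2) unfolding Y_def by auto
  qed
  \<comment> \<open>Keeping \<open>w\<close> on the arc makes the component \<open>U\<close> of
    \<open>- Y\<close> a neighbourhood of \<open>w\<close>. It then meets \<open>C\<close> along
    \<open>e\<close>, and also \<open>e'\<close>, which ends at \<open>w\<close>.\<close>
  have half: "connected (A - {a})"
  proof (rule connected_intermediate_closure)
    show "connected (A - V)" unfolding A_def by (rule open_arc[OF e(1)])
    show "A - V \<subseteq> A - {a}" using AV by auto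
    show "A - {a} \<subseteq> closure (A - V)"
      using AV end_in_closure[OF e(1) w] closure_subset[of "A - V"] unfolding A_def by auto
  qed
  have "w \<in> A - {a}" using wV a by auto
  moreover have "A - {a} \<subseteq> - Y" using AY by auto
  ultimately obtain U where U: "U \<in> components (- Y)" "A - {a} \<subseteq> U" "w \<in> U"
    using exists_component_superset[OF _ _ half, of "- Y"] by blast
  have opU: "open U" using U(1) clY open_components by blast
  have Cc: "connected C" "C \<noteq> {}" "C \<subseteq> - drawing E0"
    using C0 in_components_connected in_components_nonempty in_components_subset by blast+
  have "U \<inter> closure C \<noteq> {}"
    using e(2) U(2) AV unfolding bounds_def A_def by auto
  hence "U \<inter> C \<noteq> {}" using opU by (simp add: open_Int_closure_eq_empty)
  then obtain c where c: "c \<in> U" "c \<in> C" by auto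
  have "w \<in> closure (path_image (g e') - V)" using end_in_closure e' by blast
  hence "U \<inter> closure (path_image (g e') - V) \<noteq> {}" using U(3) by auto
  hence "U \<inter> (path_image (g e') - V) \<noteq> {}" using opU by (simp add: open_Int_closure_eq_empty)
  then obtain z where z: "z \<in> U" "z \<in> path_image (g e')" "z \<notin> V" by auto
  have zA: "z \<notin> A" using Across[of e'] e' z by auto
  \<comment> \<open>Putting \<open>e\<close> back does not separate \<open>c\<close> from
    \<open>z\<close>, as it meets \<open>Y\<close> in a single point. So \<open>z\<close> lies in
    the face \<open>C\<close> although it is a point of the drawing.\<close>
  have "connected_component (- Y) c z"
    using U(1) c(1) z(1) in_components_connected in_components_subset unfolding connected_component_def by blast
  hence "connected_component (- (Y \<union> path_image (g e))) c z"
    by (rule connected_component_avoiding_arc[OF clY arc_g[OF e(1)], rotated 1])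
       (use AY c Cc YA zA in \<open>auto simp: A_def\<close>)
  then obtain T where T: "connected T" "T \<subseteq> - drawing E0" "c \<in> T" "z \<in> T"
    unfolding connected_component_def YA A_def by blast
  have "T \<subseteq> C" using components_maximal[OF C0 T(1,2)] c(2) T(3) by blast
  hence "z \<in> C" using T(4) by auto
  moreover have "z \<in> drawing E" using z e' unfolding drawing_def by auto
  ultimately show False using C in_components_subset unfolding faces_def by blast
qed

lemma joined_iff:
  assumes "ends e = {a, b}" "a \<noteq> b"
  shows "joined F e \<longleftrightarrow> path_component (drawing F) a b"
proof -
  have "(a = pathstart (g e) \<and> b = pathfinish (g e)) \<or> (b = pathstart (g e) \<and> a = pathfinish (g e))"
    using assms unfolding ends_def by (auto simp: doubleton_eq_iff)
  thus ?thesis unfolding joined_def using path_component_sym by blast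
qed

text \<open>
  Counting replaces an analysis of the rotation at \<open>v\<close>. If no face is bounded by both \<open>e1\<close> and \<open>e2\<close>, then each
  face at \<open>e1\<close> or \<open>e2\<close> is also bounded by \<open>e3\<close>, which bounds at most two faces. So \<open>e1\<close> and \<open>e2\<close> are bridges
  and \<open>e3\<close> is not, which is impossible.
\<close>

lemma common_face_at_degree_three:
  assumes v: "v \<in> V" and inc: "{e \<in> E. v \<in> ends e} = {e1, e2, e3}" and dist: "e1 \<noteq> e2" "e1 \<noteq> e3" "e2 \<noteq> e3"
  shows "\<exists>C\<in>faces E. bounds e1 C \<and> bounds e2 C"
proof (rule ccontr)
  assume neg: "\<not> ?thesis"
  define N where "N e = {C \<in> faces E. bounds e C}" for e
  have ein: "e1 \<in> E" "e2 \<in> E" "e3 \<in> E" "v \<in> ends e1" "v \<in> ends e2" "v \<in> ends e3" using inc by auto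
  have finN: "finite (N e)" for e unfolding N_def using finite_faces[OF order_refl] by auto
  have cont: "\<exists>f\<in>{e1,e2,e3}. f \<noteq> e \<and> bounds f C" if "C \<in> N e" "e \<in> {e1,e2}" for e C
  proof -
    have "\<exists>f\<in>E. f \<noteq> e \<and> v \<in> ends f \<and> bounds f C"
      using boundary_continues[of C e v e3] that ein dist unfolding N_def by auto
    thus ?thesis using inc by blast
  qed
  have "N e1 \<subseteq> N e3" "N e2 \<subseteq> N e3" using cont[of _ e1] cont[of _ e2] neg unfolding N_def by fastforce+
  moreover have "N e1 \<inter> N e2 = {}" using neg unfolding N_def by auto
  ultimately have le: "card (N e1) + card (N e2) \<le> card (N e3)"
    using finN by (metis card_Un_disjoint card_mono Un_least)
  have cN: "card (N e) = (if joined (E - {e}) e then 2 else 1)" if "e \<in> E" for e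
    unfolding N_def by (rule card_bounded_faces[OF that])
  \<comment> \<open>Each of the three numbers is 1 or 2, so the inequality \<open>le\<close> forces
    1, 1, 2.\<close>
  have j: "\<not> joined (E - {e1}) e1" "\<not> joined (E - {e2}) e2" "joined (E - {e3}) e3"
    using le cN[OF ein(1)] cN[OF ein(2)] cN[OF ein(3)] by (auto split: if_splits)
  obtain w1 where w1: "ends e1 = {w1, v}" "w1 \<noteq> v" using other_end[OF ein(1,4)] insert_commute by metis
  obtain w2 where w2: "ends e2 = {w2, v}" "w2 \<noteq> v" using other_end[OF ein(2,5)] insert_commute by metis
  obtain w3 where w3: "ends e3 = {w3, v}" "w3 \<noteq> v" using other_end[OF ein(3,6)] insert_commute by metis
  note w = w1 w2 w3
  have wV: "w1 \<in> V" "w2 \<in> V" "w3 \<in> V"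
    using ends_eq[OF ein(1)] ends_eq[OF ein(2)] ends_eq[OF ein(3)] w by auto
  define F where "F = E - {e1,e2,e3}"
  define Z where "Z = (V - {v}) \<union> (\<Union>f\<in>F. path_image (g f))"
  have FE: "F \<subseteq> E" unfolding F_def by auto
  have vZ: "v \<notin> Z" unfolding Z_def F_def using inc ends_eq v by auto
  have AV: "path_image (g e1) \<inter> V = {w1, v}" "path_image (g e2) \<inter> V = {w2, v}"
    using ends_eq ein w by auto
  \<comment> \<open>A connection of \<open>w\<close> to \<open>w3\<close> away from \<open>v\<close>
    would continue along \<open>e3\<close> to \<open>v\<close>, and \<open>e\<close> would not be a
    bridge.\<close>
  have noZ: "\<not> path_component Z w w3"
    if "\<not> joined (E - {e}) e" "e \<in> {e1,e2}" "ends e = {w, v}" "w \<noteq> v" for e w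
  proof
    assume "path_component Z w w3"
    moreover have "Z \<subseteq> drawing (E - {e})" unfolding Z_def drawing_def F_def using that(2) by auto
    ultimately have 1: "path_component (drawing (E - {e})) w w3" by (rule path_component_of_subset[rotated])
    have "path_component (path_image (g e3)) (pathstart (g e3)) (pathfinish (g e3))"
      using arc_g ein(3) by (metis arc_imp_path path_component_def order_refl)
    moreover have "path_image (g e3) \<subseteq> drawing (E - {e})" unfolding drawing_def using ein that(2) dist by auto
    ultimately have "path_component (drawing (E - {e})) (pathstart (g e3)) (pathfinish (g e3))"
      by (rule path_component_of_subset[rotated])
    hence "path_component (drawing (E - {e})) w3 v"
      using w(5,6) joined_iff[OF w(5,6)] unfolding joined_def by blast
    hence "path_component (drawing (E - {e})) w v" using 1 path_component_trans by blast
    thus False using that joined_iff by blast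
  qed
  have sep: "\<not> path_component Z w1 w3" "\<not> path_component Z w2 w3"
    using noZ[OF j(1)] noZ[OF j(2)] w by auto
  \<comment> \<open>\<open>K\<close> is what \<open>w3\<close> reaches without \<open>v\<close>;
    \<open>M\<close> is the rest together with \<open>e1\<close> and \<open>e2\<close>. They are
    disjoint closed sets covering the drawing without \<open>e3\<close>, so no path in it leads from
    \<open>w3\<close> to \<open>v\<close>, although \<open>e3\<close> is not a bridge.\<close>
  define K where "K = path_component_set Z w3"
  define M where "M = (Z - K) \<union> (path_image (g e1) \<union> path_image (g e2))"
  have clK: "closed K" "closed (Z - K)"
    using drawing_pieces[OF FE, of "V - {v}"] unfolding K_def Z_def by auto
  have clM: "closed M" unfolding M_def using clK arc_g ein by (intro closed_Un closed_arc_image) auto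
  have w3K: "w3 \<in> K" unfolding K_def using wV(3) w(6) by (auto simp: Z_def intro!: path_component_refl)
  have vM: "v \<in> M" unfolding M_def using AV by auto
  have KZ: "K \<subseteq> Z" unfolding K_def by (rule path_component_subset)
  have dr: "drawing (E - {e3}) \<subseteq> K \<union> M"
  proof -
    have "drawing (E - {e3}) \<subseteq> Z \<union> (path_image (g e1) \<union> path_image (g e2))"
      unfolding drawing_def Z_def F_def using AV by auto
    thus ?thesis unfolding M_def by auto
  qed
  have disj: "z \<notin> K" if z: "z \<in> path_image (g e)" and e: "e \<in> {e1,e2}" for z e
  proof
    assume "z \<in> K"
    have eE: "e \<in> E" using e ein by auto
    have "z \<in> Z" using \<open>z \<in> K\<close> KZ by auto
    have "z \<in> V"
    proof (rule ccontr)
      assume "z \<notin> V"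
      then obtain f where f: "f \<in> F" "z \<in> path_image (g f)" using \<open>z \<in> Z\<close> unfolding Z_def by auto
      have "e \<noteq> f" "f \<in> E" using f(1) e unfolding F_def by auto
      thus False using arc_cross[OF eE, of f] f(2) z \<open>z \<notin> V\<close> by auto
    qed
    hence "z \<in> {w1, w2, v}" using z e AV by auto
    hence "z \<in> {w1, w2}" using vZ \<open>z \<in> Z\<close> by auto
    thus False using sep \<open>z \<in> K\<close> unfolding K_def by (auto dest: path_component_sym)
  qed
  have KM: "K \<inter> M = {}" unfolding M_def using disj by auto
  have "path_component (drawing (E - {e3})) w3 v" using j(3) joined_iff[OF w(5,6)] by simp
  then obtain p where p: "path p" "path_image p \<subseteq> drawing (E - {e3})" "pathstart p = w3" "pathfinish p = v"
    unfolding path_component_def by blast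
  define T where "T = path_image p"
  have T: "connected T" "T \<subseteq> drawing (E - {e3})" "w3 \<in> T" "v \<in> T"
    unfolding T_def using p connected_path_image pathstart_in_path_image pathfinish_in_path_image by metis+
  have "K \<inter> M \<inter> T = {}" "T \<subseteq> K \<union> M" using KM dr T(2) by auto
  hence "K \<inter> T = {} \<or> M \<inter> T = {}"
    using T(1) clK(1) clM unfolding connected_closed by blast
  thus False using T(3,4) w3K vM by auto
qed

end

section \<open>Recoloring and deletion of vertices\<close>

locale fin_graph =
  fixes V :: "'a set" and adj :: "'a \<Rightarrow> 'a \<Rightarrow> bool"
  assumes finV: "finite V"
    and adj_sym: "adj u v \<Longrightarrow> adj v u"
    and adj_irrefl: "\<not> adj v v"
begin

definition nb :: "'a set \<Rightarrow> 'a \<Rightarrow> 'a set" where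
  "nb W v = {u \<in> W. adj v u}"

abbreviation deg :: "'a set \<Rightarrow> 'a \<Rightarrow> nat" where
  "deg W v \<equiv> card (nb W v)"

definition light :: "'a set \<Rightarrow> 'a set" where
  "light W = {y \<in> W. deg W y = 3 \<or> deg W y = 4 \<and> (\<exists>z\<in>nb W y. deg W z = 3)}"

lemma finite_nb: "W \<subseteq> V \<Longrightarrow> finite (nb W v)"
  using finV finite_subset unfolding nb_def by fastforce

lemma nb_mono_card: "W' \<subseteq> W \<Longrightarrow> W \<subseteq> V \<Longrightarrow> deg W' v \<le> deg W v"
  by (intro card_mono finite_nb) (auto simp: nb_def)

end

section \<open>Recoloring moves and putting one vertex back\<close>

locale list_graph = fin_graph V adj for V :: "'a set" and adj +
  fixes L :: "'a \<Rightarrow> 'c set"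
begin

definition coloring :: "'a set \<Rightarrow> ('a \<Rightarrow> 'c) \<Rightarrow> bool" where
  "coloring W \<phi> \<longleftrightarrow> (\<forall>v\<in>W. \<phi> v \<in> L v) \<and> (\<forall>u\<in>W. \<forall>v\<in>W. adj u v \<longrightarrow> \<phi> u \<noteq> \<phi> v)"

text \<open>The condition \<open>c \<noteq> \<phi> v\<close> makes every move a genuine change, so
  that counting moves counts recolorings.\<close>

fun valid :: "'a set \<Rightarrow> ('a \<Rightarrow> 'c) \<Rightarrow> ('a \<times> 'c) list \<Rightarrow> bool" where
  "valid W \<phi> [] \<longleftrightarrow> True"
| "valid W \<phi> ((v, c) # ms) \<longleftrightarrow>
     v \<in> W \<and> c \<noteq> \<phi> v \<and> c \<in> L v \<and> (\<forall>u\<in>W. adj v u \<longrightarrow> \<phi> u \<noteq> c) \<and> valid W (\<phi>(v := c)) ms"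

fun run :: "('a \<Rightarrow> 'c) \<Rightarrow> ('a \<times> 'c) list \<Rightarrow> 'a \<Rightarrow> 'c" where
  "run \<phi> [] = \<phi>"
| "run \<phi> ((v, c) # ms) = run (\<phi>(v := c)) ms"

definition moves_of :: "'a \<Rightarrow> ('a \<times> 'c) list \<Rightarrow> nat" where
  "moves_of v ms = length (filter (\<lambda>m. fst m = v) ms)"

text \<open>The budget depends on the vertex, since later insertions rely on some vertices staying
  well below 30.\<close>

definition good :: "'a set \<Rightarrow> ('a \<Rightarrow> nat) \<Rightarrow> bool" where
  "good W c \<longleftrightarrow> (\<forall>\<alpha> \<beta>. coloring W \<alpha> \<longrightarrow> coloring W \<beta> \<longrightarrow>
     (\<exists>ms. valid W \<alpha> ms \<and> (\<forall>v\<in>W. run \<alpha> ms v = \<beta> v \<and> moves_of v ms \<le> c v)))"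

lemma moves_of_simps [simp]:
  "moves_of v [] = 0" "moves_of v ((u, c) # ms) = (if u = v then Suc (moves_of v ms) else moves_of v ms)"
  "moves_of v (ms @ ms') = moves_of v ms + moves_of v ms'"
  by (simp_all add: moves_of_def)

lemma run_append: "run \<phi> (ms @ ms') = run (run \<phi> ms) ms'"
  by (induction ms arbitrary: \<phi>) auto

lemma valid_append: "valid W \<phi> (ms @ ms') \<longleftrightarrow> valid W \<phi> ms \<and> valid W (run \<phi> ms) ms'"
  by (induction ms arbitrary: \<phi>) auto

lemma run_cong: "u \<in> W \<Longrightarrow> (\<And>w. w \<in> W \<Longrightarrow> \<phi> w = \<psi> w) \<Longrightarrow> run \<phi> ms u = run \<psi> ms u"
proof (induction ms arbitrary: \<phi> \<psi>)
  case (Cons m ms)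
  obtain v c where m: "m = (v, c)" by (cases m)
  have "run (\<phi>(v := c)) ms u = run (\<psi>(v := c)) ms u"
    by (rule Cons.IH) (use Cons.prems in auto)
  thus ?case by (simp add: m)
qed simp

lemma valid_cong: "(\<And>w. w \<in> W \<Longrightarrow> \<phi> w = \<psi> w) \<Longrightarrow> valid W \<phi> ms = valid W \<psi> ms"
proof (induction ms arbitrary: \<phi> \<psi>)
  case (Cons m ms)
  obtain v c where m: "m = (v, c)" by (cases m)
  have "valid W (\<phi>(v := c)) ms = valid W (\<psi>(v := c)) ms"
    by (rule Cons.IH) (use Cons.prems in auto)
  thus ?case using Cons.prems by (auto simp: m)
qed simp

lemma coloring_upd:
  assumes "coloring W \<phi>" "v \<in> W" "c \<in> L v" "\<forall>u\<in>W. adj v u \<longrightarrow> \<phi> u \<noteq> c"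
  shows "coloring W (\<phi>(v := c))"
  using assms adj_sym adj_irrefl unfolding coloring_def by (auto split: if_splits)

text \<open>
  Whenever a neighbour of \<open>v\<close> is about to receive the colour of \<open>v\<close>, the vertex \<open>v\<close> moves to a colour that differs
  from the current colours of its neighbours and from their next \<open>q\<close> new colours. The parameter \<open>j\<close> counts the
  upcoming neighbour moves that the current colour of \<open>v\<close> survives.
\<close>

lemma extend_moves:
  assumes v: "v \<notin> W" "v \<in> V" and W: "W \<subseteq> V" and q: "q \<ge> 1"
    and big: "card (L v) \<ge> deg W v + q + 1"
  shows "coloring (insert v W) \<phi> \<Longrightarrow> valid W \<phi> ms \<Longrightarrow>
    \<phi> v \<notin> set (take j (map snd (filter (\<lambda>m. fst m \<in> nb W v) ms))) \<Longrightarrow>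
    \<exists>ms'. valid (insert v W) \<phi> ms' \<and>
      (\<forall>u\<in>W. run \<phi> ms' u = run \<phi> ms u \<and> moves_of u ms' = moves_of u ms) \<and>
      moves_of v ms' \<le> (length (filter (\<lambda>m. fst m \<in> nb W v) ms) - j + (q - 1)) div q"
proof (induction ms arbitrary: \<phi> j)
  case Nil
  show ?case by (rule exI[of _ "[]"]) simp
next
  case (Cons m ms)
  obtain u c where m: "m = (u, c)" by (cases m)
  let ?N = "nb W v" and ?W = "insert v W"
  let ?T = "map snd (filter (\<lambda>m. fst m \<in> ?N) ms)" and ?n = "length (filter (\<lambda>m. fst m \<in> ?N) ms)"
  have u: "u \<in> W" "c \<noteq> \<phi> u" "c \<in> L u" "\<forall>w\<in>W. adj u w \<longrightarrow> \<phi> w \<noteq> c" "valid W (\<phi>(u := c)) ms"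
    using Cons.prems(2) m by auto
  have uv: "u \<noteq> v" using u v by auto
  have direct: ?case if ok: "adj u v \<longrightarrow> \<phi> v \<noteq> c" and j': "\<phi> v \<notin> set (take j' ?T)"
    and le: "?n - j' \<le> length (filter (\<lambda>m. fst m \<in> ?N) (m # ms)) - j" for j'
  proof -
    have okW: "\<forall>w\<in>?W. adj u w \<longrightarrow> \<phi> w \<noteq> c" using u ok by auto
    have col: "coloring ?W (\<phi>(u := c))" by (rule coloring_upd[OF Cons.prems(1)]) (use u okW in auto)
    have jv: "(\<phi>(u := c)) v \<notin> set (take j' ?T)" using j' uv by simp
    obtain ms' where ms': "valid ?W (\<phi>(u := c)) ms'"
      "\<forall>w\<in>W. run (\<phi>(u := c)) ms' w = run (\<phi>(u := c)) ms w \<and> moves_of w ms' = moves_of w ms"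
      "moves_of v ms' \<le> (?n - j' + (q - 1)) div q"
      using Cons.IH[OF col u(5) jv] by blast
    have "(?n - j' + (q - 1)) div q \<le> (length (filter (\<lambda>m. fst m \<in> ?N) (m # ms)) - j + (q - 1)) div q"
      using le by (intro div_le_mono add_le_mono1)
    hence "moves_of v ((u, c) # ms') \<le> (length (filter (\<lambda>m. fst m \<in> ?N) (m # ms)) - j + (q - 1)) div q"
      using ms'(3) uv by simp
    moreover have "valid ?W \<phi> ((u, c) # ms')"
      unfolding valid.simps using ms'(1) u okW by blast
    moreover have "\<forall>w\<in>W. run \<phi> ((u, c) # ms') w = run \<phi> (m # ms) w \<and> moves_of w ((u, c) # ms') = moves_of w (m # ms)"
      unfolding m run.simps moves_of_simps using ms'(2) by simp
    ultimately show ?thesis by blast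
  qed
  show ?case
  proof (cases "u \<in> ?N")
    case False
    hence na: "\<not> adj u v" using u(1) adj_sym unfolding nb_def by auto
    show ?thesis
      by (rule direct[of j]) (use na False Cons.prems(3) m in auto)
  next
    case True
    show ?thesis
    proof (cases "\<phi> v = c")
      case False
      \<comment> \<open>A move of a neighbour uses up the first of the \<open>j\<close> colours that
        \<open>v\<close> is known to avoid.\<close>
      show ?thesis
        by (rule direct[of "j - 1"]) (use False True Cons.prems(3) m in \<open>cases j; auto\<close>)+
    next
      case eq: True
      have j0: "j = 0" using Cons.prems(3) True m eq by (cases j) auto
      \<comment> \<open>At most \<open>deg W v\<close> current colours and \<open>q\<close> upcoming
        ones, the first of them being \<open>c\<close>; the list of \<open>v\<close> has one colour
        more.\<close>
      define B where "B = \<phi> ` ?N \<union> set (take q (c # ?T))"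
      have finN: "finite ?N" using W finV finite_subset unfolding nb_def by fastforce
      have "card B \<le> card (\<phi> ` ?N) + card (set (take q (c # ?T)))" unfolding B_def by (rule card_Un_le)
      also have "\<dots> \<le> deg W v + q"
        using card_image_le[OF finN, of \<phi>] card_length[of "take q (c # ?T)"] by (simp del: take_Suc_Cons)
      finally have "card B < card (L v)" using big by simp
      moreover have "finite B" unfolding B_def using finN by simp
      ultimately have "\<not> L v \<subseteq> B" using card_mono[of B "L v"] by linarith
      then obtain x where x: "x \<in> L v" "x \<notin> B" by auto
      have tq: "take q (c # ?T) = c # take (q - 1) ?T" using q by (cases q) auto
      have xc: "x \<noteq> c" "x \<notin> set (take (q - 1) ?T)" using x(2) unfolding B_def tq by auto
      have xN: "\<forall>w\<in>?W. adj v w \<longrightarrow> \<phi> w \<noteq> x" using x(2) adj_irrefl unfolding B_def nb_def by auto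
      have col1: "coloring ?W (\<phi>(v := x))"
        by (rule coloring_upd[OF Cons.prems(1)]) (use x xN in auto)
      let ?\<psi> = "(\<phi>(v := x))(u := c)"
      have okW: "\<forall>w\<in>?W. adj u w \<longrightarrow> (\<phi>(v := x)) w \<noteq> c" using u xc v by auto
      have col: "coloring ?W ?\<psi>" by (rule coloring_upd[OF col1]) (use u okW in auto)
      have agree: "w \<in> W \<Longrightarrow> ?\<psi> w = (\<phi>(u := c)) w" for w using v by auto
      have "valid W ?\<psi> ms = valid W (\<phi>(u := c)) ms" by (rule valid_cong) (rule agree)
      hence val: "valid W ?\<psi> ms" using u(5) by (rule iffD2)
      have "?\<psi> v \<notin> set (take (q - 1) ?T)" using xc uv by auto
      from Cons.IH[OF col val this] obtain ms' where ms': "valid ?W ?\<psi> ms'"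
        "\<forall>w\<in>W. run ?\<psi> ms' w = run ?\<psi> ms w \<and> moves_of w ms' = moves_of w ms"
        "moves_of v ms' \<le> (?n - (q - 1) + (q - 1)) div q" by blast
      \<comment> \<open>One move of \<open>v\<close> pays for \<open>q\<close> neighbour moves: the
        present one and the next \<open>q - 1\<close>. If fewer than \<open>q - 1\<close> remain,
        truncated subtraction makes the left side exactly 1, which is treated separately.\<close>
      have cnt: "Suc ((?n - (q - 1) + (q - 1)) div q) \<le> (Suc ?n + (q - 1)) div q"
      proof -
        have "Suc ((?n - (q - 1) + (q - 1)) div q) = (?n - (q - 1) + (q - 1) + q) div q"
          using div_add_self2[of q "?n - (q - 1) + (q - 1)"] q by linarith
        also have "\<dots> \<le> (Suc ?n + (q - 1)) div q"
        proof (cases "?n \<ge> q - 1")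
          case True
          hence "?n - (q - 1) + (q - 1) + q = Suc ?n + (q - 1)" using q by linarith
          thus ?thesis by (simp only: order_refl)
        next
          case False
          hence "?n - (q - 1) + (q - 1) + q = (q - 1) + q" by linarith
          moreover have "(q - 1 + q) div q = 1" by (rule div_nat_eqI) (use q in simp_all)
          ultimately have "(?n - (q - 1) + (q - 1) + q) div q = 1" by (simp only:)
          also have "1 \<le> (Suc ?n + (q - 1)) div q"
            using div_le_mono[of q "Suc ?n + (q - 1)" q] q by simp
          finally show ?thesis .
        qed
        finally show ?thesis .
      qed
      have "run ?\<psi> ms w = run (\<phi>(u := c)) ms w" if "w \<in> W" for w
        by (rule run_cong[OF that]) (rule agree)
      hence "\<forall>w\<in>W. run \<phi> ((v, x) # (u, c) # ms') w = run \<phi> (m # ms) w \<and>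
          moves_of w ((v, x) # (u, c) # ms') = moves_of w (m # ms)"
        unfolding m run.simps moves_of_simps using ms'(2) v by auto
      moreover have "valid ?W \<phi> ((v, x) # (u, c) # ms')"
        unfolding valid.simps using ms'(1) u okW uv x xN xc eq by auto
      moreover have "moves_of v ((v, x) # (u, c) # ms') \<le>
          (length (filter (\<lambda>m. fst m \<in> ?N) (m # ms)) - j + (q - 1)) div q"
        using ms'(3) cnt uv m True j0 by simp
      ultimately show ?thesis by blast
    qed
  qed
qed

lemma length_filter_eq_sum:
  assumes "finite N"
  shows "length (filter (\<lambda>m. fst m \<in> N) ms) = (\<Sum>u\<in>N. moves_of u ms)"
proof (induction ms)
  case (Cons m ms)
  obtain u c where m: "m = (u, c)" by (cases m)
  have "(\<Sum>w\<in>N. moves_of w (m # ms)) = (\<Sum>w\<in>N. moves_of w ms + (if w = u then 1 else 0))"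
    unfolding m by (intro sum.cong) auto
  thus ?case using Cons assms m by (simp add: sum.distrib sum.delta)
qed (simp add: moves_of_def)

text \<open>The quotient is \<open>t / q\<close> rounded up. The extra 1 pays for a last move of
  \<open>v\<close> to its target colour, which is possible once all of \<open>W\<close> has reached
  \<open>\<beta>\<close>.\<close>

lemma good_insert:
  assumes "good W c" and v: "v \<notin> W" "v \<in> V" and W: "W \<subseteq> V" and q: "q \<ge> 1"
    and big: "card (L v) \<ge> deg W v + q + 1"
    and t: "(\<Sum>u\<in>nb W v. c u) \<le> t" and k: "(t + (q - 1)) div q + 1 \<le> k"
  shows "good (insert v W) (c(v := k))"
  unfolding good_def
proof (intro allI impI)
  fix \<alpha> \<beta> assume \<alpha>: "coloring (insert v W) \<alpha>" and \<beta>: "coloring (insert v W) \<beta>"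
  let ?W = "insert v W"
  have "coloring W \<alpha>" "coloring W \<beta>" using \<alpha> \<beta> unfolding coloring_def by auto
  then obtain ms where ms: "valid W \<alpha> ms" "\<forall>v\<in>W. run \<alpha> ms v = \<beta> v \<and> moves_of v ms \<le> c v"
    using assms(1) unfolding good_def by blast
  obtain ms' where ms': "valid ?W \<alpha> ms'"
      "\<forall>u\<in>W. run \<alpha> ms' u = run \<alpha> ms u \<and> moves_of u ms' = moves_of u ms"
      "moves_of v ms' \<le> (length (filter (\<lambda>m. fst m \<in> nb W v) ms) - 0 + (q - 1)) div q"
    using extend_moves[OF v W q big \<alpha> ms(1), of 0] by auto
  have finN: "finite (nb W v)" using W finV finite_subset unfolding nb_def by fastforce
  have "length (filter (\<lambda>m. fst m \<in> nb W v) ms) \<le> (\<Sum>u\<in>nb W v. c u)"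
    unfolding length_filter_eq_sum[OF finN] using ms(2) by (intro sum_mono) (auto simp: nb_def)
  hence "(length (filter (\<lambda>m. fst m \<in> nb W v) ms) - 0 + (q - 1)) div q \<le> (t + (q - 1)) div q"
    using t by (intro div_le_mono) simp
  hence cnt: "moves_of v ms' + 1 \<le> k" using ms'(3) k by simp
  have runW: "run \<alpha> ms' u = \<beta> u" if "u \<in> W" for u using ms'(2) ms(2) that by simp
  show "\<exists>ms. valid ?W \<alpha> ms \<and> (\<forall>u\<in>?W. run \<alpha> ms u = \<beta> u \<and> moves_of u ms \<le> (c(v := k)) u)"
  proof (cases "run \<alpha> ms' v = \<beta> v")
    case True
    thus ?thesis using ms' ms runW cnt v by (intro exI[of _ ms']) auto
  next
    case False
    have "\<forall>u\<in>?W. adj v u \<longrightarrow> run \<alpha> ms' u \<noteq> \<beta> v"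
      using runW \<beta> adj_irrefl unfolding coloring_def by (metis insertE insertI1 insertI2)
    hence "valid ?W \<alpha> (ms' @ [(v, \<beta> v)])" using ms'(1) False \<beta> unfolding coloring_def by (auto simp: valid_append)
    thus ?thesis using ms' ms runW cnt v by (intro exI[of _ "ms' @ [(v, \<beta> v)]"]) (auto simp: run_append)
  qed
qed

lemma good_mono: "good W c \<Longrightarrow> (\<And>v. v \<in> W \<Longrightarrow> c v \<le> c' v) \<Longrightarrow> good W c'"
  unfolding good_def by (meson order_trans)

lemma good_empty: "good {} c"
  unfolding good_def by (auto intro: exI[of _ "[]"])

end

section \<open>Reducible configurations for lists of size 7\<close>

locale list7_graph = list_graph V adj L for V :: "'a set" and adj and L :: "'a \<Rightarrow> 'c set" +
  assumes card_L: "v \<in> V \<Longrightarrow> card (L v) = 7"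
begin

text \<open>Two neighbours at 30 and \<open>q = 7 - 2 - 1 = 4\<close> give
  \<open>60 / 4 + 1\<close>.\<close>

lemma good_insert_deg2:
  assumes "good W c" "\<And>u. u \<in> W \<Longrightarrow> c u \<le> 30" "v \<in> V" "v \<notin> W" "W \<subseteq> V" "deg W v \<le> 2"
  shows "good (insert v W) (c(v := 16))"
proof -
  have "(\<Sum>u\<in>nb W v. c u) \<le> deg W v * 30"
    using sum_bounded_above[of "nb W v" c 30] assms(2) by (auto simp: nb_def)
  thus ?thesis using assms card_L[OF assms(3)] by (intro good_insert[where q = 4 and t = 60]) auto
qed

text \<open>One neighbour \<open>x\<close> has the smaller budget \<open>s\<close>. Here
  \<open>q = 3\<close>, and \<open>s + 62\<close> is \<open>s + 60\<close> plus the 2 needed to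
  round up. The values used are \<open>s = 16\<close>, giving 27, and \<open>s = 27\<close>, giving
  30.\<close>

lemma good_insert_deg3:
  assumes "good W c" "\<And>u. u \<in> W \<Longrightarrow> c u \<le> 30" "v \<in> V" "v \<notin> W" "W \<subseteq> V" "deg W v \<le> 3"
    and "x \<in> nb W v" "c x \<le> s" "(s + 62) div 3 + 1 \<le> k"
  shows "good (insert v W) (c(v := k))"
proof -
  have "(\<Sum>u\<in>nb W v. c u) = c x + (\<Sum>u\<in>nb W v - {x}. c u)"
    using finite_nb[OF assms(5)] assms(7) by (rule sum.remove)
  also have "(\<Sum>u\<in>nb W v - {x}. c u) \<le> card (nb W v - {x}) * 30"
    using sum_bounded_above[of "nb W v - {x}" c 30] assms(2) by (auto simp: nb_def)
  also have "card (nb W v - {x}) \<le> 2" using assms(6,7) finite_nb[OF assms(5)] by simp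
  finally have "(\<Sum>u\<in>nb W v. c u) \<le> s + 60" using assms(8) by simp
  thus ?thesis using assms card_L[OF assms(3)]
    by (intro good_insert[where q = 3 and t = "s + 60"]) auto
qed

lemma good_delete_deg2:
  assumes "W \<subseteq> V" "x \<in> W" "deg W x \<le> 2" "good (W - {x}) (\<lambda>_. 30)"
  shows "good W (\<lambda>_. 30)"
proof -
  have "good (insert x (W - {x})) ((\<lambda>_. 30)(x := 16))"
    using assms nb_mono_card[of "W - {x}" W x] by (intro good_insert_deg2) auto
  thus ?thesis using assms(2) by (auto simp: insert_absorb intro: good_mono)
qed

text \<open>In the absence of \<open>z\<close>, the vertex \<open>x\<close> has only two neighbours
  and costs 16, which makes it the cheap neighbour of \<open>z\<close>.\<close>

lemma good_delete_adjacent_deg3: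
  assumes W: "W \<subseteq> V" and x: "x \<in> W" "deg W x = 3" and z: "z \<in> nb W x" "deg W z = 3"
    and g: "good (W - {x, z}) (\<lambda>_. 30)"
  shows "good W (\<lambda>_. 30)"
proof -
  have zW: "z \<in> W" "z \<noteq> x" "adj z x" using z adj_sym adj_irrefl unfolding nb_def by auto
  have "nb (W - {x, z}) x \<subseteq> nb W x - {z}" unfolding nb_def by auto
  hence "deg (W - {x, z}) x \<le> card (nb W x - {z})" using finite_nb[OF W] by (intro card_mono) auto
  hence "deg (W - {x, z}) x \<le> 2" using z x finite_nb[OF W] by simp
  hence "good (insert x (W - {x, z})) ((\<lambda>_. 30)(x := 16))"
    using g W x by (intro good_insert_deg2) auto
  moreover have "insert x (W - {x, z}) = W - {z}" using x zW by auto
  ultimately have "good (W - {z}) ((\<lambda>_. 30)(x := 16))" by simp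
  hence "good (insert z (W - {z})) (((\<lambda>_. 30)(x := 16))(z := 27))"
    by (rule good_insert_deg3[where x = x and s = 16])
       (use W zW x z nb_mono_card[of "W - {z}" W z] in \<open>auto simp: nb_def\<close>)
  thus ?thesis using zW by (auto simp: insert_absorb intro: good_mono)
qed

text \<open>
  After the deletion, \<open>x\<close> is put back first and is recolored at most 16 times, then its light neighbours of
  degree 4 at most 27 times each, and finally the vertices of degree 3 at most 30 times each.
\<close>

lemma good_delete_light_star:
  assumes W: "W \<subseteq> V" and x: "x \<in> W" "deg W x \<ge> 4" "deg W x \<le> card (nb W x \<inter> light W) + 2"
    and IH: "\<And>W'. W' \<subset> W \<Longrightarrow> good W' (\<lambda>_. 30)"
  shows "good W (\<lambda>_. 30)"
proof -
  define S where "S = {y \<in> nb W x. deg W y = 4 \<and> (\<exists>z\<in>nb W y. deg W z = 3)}"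
  define D where "D = {z \<in> W. deg W z = 3 \<and> (adj z x \<or> (\<exists>y\<in>S. adj z y))}"
  define W0 where "W0 = W - insert x (S \<union> D)"
  have fin: "finite S" "finite D"
    using finite_nb[OF W] finite_subset[OF W finV] unfolding S_def D_def by auto
  have SW: "S \<subseteq> W" "D \<subseteq> W" "x \<notin> S" "x \<notin> D" "S \<inter> D = {}"
    using adj_irrefl x(2) unfolding S_def D_def nb_def by auto
  have disj: "x \<notin> W0" "S \<inter> W0 = {}" "D \<inter> W0 = {}" "W0 \<subseteq> W" unfolding W0_def by auto
  have "W0 \<subset> W" using x unfolding W0_def by auto
  hence g0: "good W0 (\<lambda>_. 30)" by (rule IH)
  \<comment> \<open>A light neighbour of \<open>x\<close> has degree 3 and is in \<open>D\<close>,
    or has degree 4 and is in \<open>S\<close>.\<close>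
  have "nb W0 x \<subseteq> nb W x - light W"
    unfolding W0_def nb_def light_def S_def D_def using adj_sym by (auto simp: nb_def)
  hence "deg W0 x \<le> card (nb W x - light W)" using finite_nb[OF W] by (intro card_mono) auto
  also have "card (nb W x - light W) = deg W x - card (nb W x \<inter> light W)"
    using finite_nb[OF W] by (metis card_Diff_subset_Int finite_Int)
  finally have "deg W0 x \<le> 2" using x(3) by simp
  hence g1: "good (insert x W0) ((\<lambda>_. 30)(x := 16))"
    using g0 W x disj by (intro good_insert_deg2) auto
  define c1 where "c1 T = (\<lambda>u. if u = x then 16 else if u \<in> T then 27 else 30 :: nat)" for T :: "'a set"
  have g2: "good (T \<union> insert x W0) (c1 T)" if "T \<subseteq> S" for T
  proof -
    have "finite T" using that fin(1) by (rule finite_subset)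
    thus ?thesis using that
    proof (induction T)
      case empty
      show ?case using g1 by (auto intro: good_mono simp: c1_def)
    next
      case (insert y T)
      let ?U = "T \<union> insert x W0"
      have y: "y \<in> S" "y \<in> W" "y \<notin> ?U" "y \<noteq> x" using insert.prems insert.hyps disj SW by auto
      have U: "?U \<subseteq> V" "?U \<subseteq> W" using insert.prems SW W x disj by auto
      obtain z where z: "z \<in> nb W y" "deg W z = 3" using y(1) unfolding S_def by auto
      \<comment> \<open>All of \<open>D\<close> is still missing when \<open>y\<close> returns, so
        \<open>y\<close> sees at most three neighbours, among them the cheap
        \<open>x\<close>.\<close>
      have "z \<in> D" using z y(1) adj_sym unfolding D_def nb_def by auto
      hence "z \<notin> ?U" using disj SW insert.prems by auto
      hence "nb ?U y \<subseteq> nb W y - {z}" using U unfolding nb_def by auto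
      hence "deg ?U y \<le> card (nb W y - {z})" using finite_nb[OF W] by (intro card_mono) auto
      also have "\<dots> = 3" using z(1) y(1) finite_nb[OF W] unfolding S_def by simp
      finally have d: "deg ?U y \<le> 3" .
      have "x \<in> nb ?U y" using y(1) adj_sym unfolding S_def nb_def by auto
      hence "good (insert y ?U) ((c1 T)(y := 27))"
        using insert y U W d by (intro good_insert_deg3[where x = x and s = 16]) (auto simp: c1_def)
      moreover have "insert y ?U = insert y T \<union> insert x W0" by auto
      moreover have "(c1 T)(y := 27) = c1 (insert y T)" using y(4) by (auto simp: c1_def)
      ultimately show ?case by simp
    qed
  qed
  have g3: "good (T \<union> (S \<union> insert x W0)) (c1 S)" if "T \<subseteq> D" for T
  proof -
    have "finite T" using that fin(2) by (rule finite_subset)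
    thus ?thesis using that
    proof (induction T)
      case empty
      show ?case using g2[of S] by simp
    next
      case (insert z T)
      let ?U = "T \<union> (S \<union> insert x W0)"
      have z: "z \<in> D" "z \<in> W" "z \<notin> ?U" "z \<noteq> x" "z \<notin> S" using insert.prems insert.hyps disj SW by auto
      have U: "?U \<subseteq> V" "?U \<subseteq> W" using insert.prems SW W x disj by auto
      have d: "deg ?U z \<le> 3" using nb_mono_card[OF U(2) W, of z] z(1) unfolding D_def by auto
      \<comment> \<open>The cheap neighbour of \<open>z\<close> is \<open>x\<close> with budget 16
        or a vertex of \<open>S\<close> with budget 27.\<close>
      obtain y where "adj z y" "y = x \<or> y \<in> S" using z(1) unfolding D_def by auto
      hence y: "y \<in> nb ?U z" "c1 S y \<le> 27" by (auto simp: nb_def c1_def)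
      have "good (insert z ?U) ((c1 S)(z := 30))"
        using insert y z U W d by (intro good_insert_deg3[where x = y and s = 27]) (auto simp: c1_def)
      moreover have "insert z ?U = insert z T \<union> (S \<union> insert x W0)" by auto
      moreover have "(c1 S)(z := 30) = c1 S" using z by (auto simp: c1_def)
      ultimately show ?case by simp
    qed
  qed
  have "D \<union> (S \<union> insert x W0) = W" using SW x unfolding W0_def by auto
  thus ?thesis using g3[of D] by (auto intro: good_mono simp: c1_def)
qed

text \<open>Degrees and lightness refer to the current \<open>W\<close> and change under deletion,
  so reducibility is required of every nonempty subset.\<close>

lemma good_if_reducible:
  assumes red: "\<And>W. W \<subseteq> V \<Longrightarrow> W \<noteq> {} \<Longrightarrow> (\<exists>x\<in>W. deg W x \<le> 2) \<or>
      (\<exists>x\<in>W. \<exists>z\<in>nb W x. deg W x = 3 \<and> deg W z = 3) \<or>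
      (\<exists>x\<in>W. deg W x \<ge> 4 \<and> deg W x \<le> card (nb W x \<inter> light W) + 2)"
    and W: "W \<subseteq> V"
  shows "good W (\<lambda>_. 30)"
proof -
  have "finite W" using W finV by (rule finite_subset)
  thus ?thesis using W
  proof (induction W rule: finite_psubset_induct)
    case (psubset W)
    have IH: "good W' (\<lambda>_. 30)" if "W' \<subset> W" for W' using psubset that by auto
    show ?case
    proof (cases "W = {}")
      case False
      from red[OF psubset.prems False] consider
        x where "x \<in> W" "deg W x \<le> 2"
        | x z where "x \<in> W" "z \<in> nb W x" "deg W x = 3" "deg W z = 3"
        | x where "x \<in> W" "deg W x \<ge> 4" "deg W x \<le> card (nb W x \<inter> light W) + 2" by blast
      thus ?thesis
      proof cases
        case 1
        thus ?thesis using IH[of "W - {x}"] psubset.prems by (intro good_delete_deg2[of W x]) auto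
      next
        case 2
        thus ?thesis using IH[of "W - {x, z}"] psubset.prems
          by (intro good_delete_adjacent_deg3[of W x z]) auto
      next
        case 3
        thus ?thesis using IH psubset.prems by (intro good_delete_light_star[of W x]) auto
      qed
    qed (simp add: good_empty)
  qed
qed

end

section \<open>Discharging\<close>

text \<open>The handshake lemma, for the whole graph and for the boundary of a face.\<close>

lemma sum_card_incident:
  assumes "finite VC" "finite EC" "\<And>e. e \<in> EC \<Longrightarrow> e \<subseteq> VC \<and> card e = 2"
  shows "(\<Sum>u\<in>VC. card {e\<in>EC. u \<in> e}) = 2 * card EC"
proof -
  have "(\<Sum>u\<in>VC. card {e\<in>EC. u \<in> e}) = (\<Sum>e\<in>EC. 2)"
  proof (rule sum_multicount_gen[OF assms(1,2)], rule ballI)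
    fix e assume "e \<in> EC"
    hence "{u \<in> VC. u \<in> e} = e" "card e = 2" using assms(3) by auto
    thus "card {u \<in> VC. u \<in> e} = 2" by simp
  qed
  thus ?thesis by simp
qed

text \<open>Only pairs inside \<open>V\<close> are constrained, so an induced subgraph is obtained
  by shrinking \<open>V\<close> and keeping \<open>adj\<close>, \<open>p\<close> and
  \<open>\<gamma>\<close>.\<close>

locale planar_graph = fin_graph V adj for V :: "'a set" and adj +
  fixes p :: "'a \<Rightarrow> complex" and \<gamma> :: "'a set \<Rightarrow> real \<Rightarrow> complex"
  assumes tri: "adj u v \<Longrightarrow> adj v w \<Longrightarrow> \<not> adj w u"
    and inj: "inj_on p V"
    and arc: "u \<in> V \<Longrightarrow> v \<in> V \<Longrightarrow> adj u v \<Longrightarrow> arc (\<gamma> {u, v})"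
    and arc_ends: "u \<in> V \<Longrightarrow> v \<in> V \<Longrightarrow> adj u v \<Longrightarrow>
      {pathstart (\<gamma> {u, v}), pathfinish (\<gamma> {u, v})} = {p u, p v}"
    and arc_V: "u \<in> V \<Longrightarrow> v \<in> V \<Longrightarrow> adj u v \<Longrightarrow> path_image (\<gamma> {u, v}) \<inter> p ` V = {p u, p v}"
    and cross: "u \<in> V \<Longrightarrow> v \<in> V \<Longrightarrow> adj u v \<Longrightarrow> x \<in> V \<Longrightarrow> y \<in> V \<Longrightarrow> adj x y \<Longrightarrow> {u, v} \<noteq> {x, y} \<Longrightarrow>
      path_image (\<gamma> {u, v}) \<inter> path_image (\<gamma> {x, y}) \<subseteq> p ` V"
begin

definition edges :: "'a set set" where
  "edges = {{u, v} | u v. u \<in> V \<and> v \<in> V \<and> adj u v}"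

abbreviation N :: "'a \<Rightarrow> 'a set" where "N \<equiv> nb V"
abbreviation d :: "'a \<Rightarrow> nat" where "d v \<equiv> card (N v)"

lemma N_D: "u \<in> N v \<Longrightarrow> u \<in> V \<and> adj v u \<and> adj u v \<and> u \<noteq> v"
  unfolding nb_def using adj_sym adj_irrefl by auto

lemma N_sym: "v \<in> V \<Longrightarrow> u \<in> N v \<Longrightarrow> v \<in> N u"
  unfolding nb_def using adj_sym by auto

lemma finN: "finite (N v)" by (rule finite_nb) simp

lemma edgesE:
  assumes "e \<in> edges"
  obtains u v where "e = {u, v}" "u \<in> V" "v \<in> N u" "u \<in> N v" "v \<in> V" "u \<noteq> v" "adj u v"
proof -
  obtain u v where *: "e = {u, v}" "u \<in> V" "v \<in> V" "adj u v" using assms unfolding edges_def by auto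
  show ?thesis by (rule that[of u v]) (use * adj_sym adj_irrefl in \<open>auto simp: nb_def\<close>)
qed

lemma edgeI: "v \<in> V \<Longrightarrow> u \<in> N v \<Longrightarrow> {v, u} \<in> edges"
  unfolding edges_def nb_def by blast

lemma edge_memI: "{v, u} \<in> edges \<Longrightarrow> u \<in> N v"
  by (erule edgesE) (auto simp: doubleton_eq_iff)

lemma finite_edges: "finite edges"
proof -
  have "edges \<subseteq> Pow V" unfolding edges_def by auto
  thus ?thesis using finV by (meson finite_Pow_iff finite_subset)
qed

sublocale pa: plane_arcs "p ` V" edges \<gamma>
proof
  show "finite (p ` V)" using finV by simp
  show "finite edges" by (rule finite_edges)
  show "Path_Connected.arc (\<gamma> e)" if "e \<in> edges" for e
    using that arc by (auto elim!: edgesE)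
  show "path_image (\<gamma> e) \<inter> p ` V = {pathstart (\<gamma> e), pathfinish (\<gamma> e)}" if "e \<in> edges" for e
    using that by (rule edgesE) (simp add: arc_V arc_ends)
  show "path_image (\<gamma> e) \<inter> path_image (\<gamma> e') \<subseteq> p ` V" if "e \<in> edges" "e' \<in> edges" "e \<noteq> e'" for e e'
  proof -
    obtain u v where e: "e = {u, v}" "u \<in> V" "v \<in> V" "adj u v"
      using \<open>e \<in> edges\<close> unfolding edges_def by blast
    obtain x y where e': "e' = {x, y}" "x \<in> V" "y \<in> V" "adj x y"
      using \<open>e' \<in> edges\<close> unfolding edges_def by blast
    show ?thesis using cross[OF e(2-4) e'(2-4)] that(3) unfolding e(1) e'(1) by simp
  qed
qed

lemma ends_edge: "e \<in> edges \<Longrightarrow> pa.ends e = p ` e"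
  by (erule edgesE) (simp add: pa.ends_def arc_ends)

lemma mem_ends: "e \<in> edges \<Longrightarrow> v \<in> V \<Longrightarrow> p v \<in> pa.ends e \<longleftrightarrow> v \<in> e"
  using inj by (auto simp: ends_edge elim!: edgesE dest: inj_onD)

lemma edges_at: assumes "v \<in> V" shows "{e \<in> edges. v \<in> e} = (\<lambda>u. {v, u}) ` N v"
proof
  show "{e \<in> edges. v \<in> e} \<subseteq> (\<lambda>u. {v, u}) ` N v"
  proof
    fix e assume "e \<in> {e \<in> edges. v \<in> e}"
    hence e: "e \<in> edges" "v \<in> e" by auto
    obtain x y where *: "e = {x, y}" "y \<in> N x" "x \<in> N y" using e(1) by (rule edgesE)
    thus "e \<in> (\<lambda>u. {v, u}) ` N v" using e(2) by (auto simp: insert_commute)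
  qed
  show "(\<lambda>u. {v, u}) ` N v \<subseteq> {e \<in> edges. v \<in> e}" using edgeI[OF assms] by auto
qed

lemma inj_pair: "inj_on (\<lambda>u. {v, u}) A"
  by (auto simp: inj_on_def doubleton_eq_iff)

lemma card_edges_at: "v \<in> V \<Longrightarrow> card {e \<in> edges. v \<in> e} = d v"
  by (simp add: edges_at card_image[OF inj_pair])

lemma card_edge: "e \<in> edges \<Longrightarrow> e \<subseteq> V \<and> card e = 2"
  by (erule edgesE) auto

lemma sum_d: "(\<Sum>v\<in>V. d v) = 2 * card edges"
  using sum_card_incident[OF finV finite_edges card_edge] card_edges_at by simp

section \<open>Face boundaries as sets of edges\<close>

abbreviation \<F> :: "complex set set" where "\<F> \<equiv> pa.faces edges"

definition bd :: "complex set \<Rightarrow> 'a set set" where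
  "bd C = {e \<in> edges. pa.bounds e C}"

lemma finite_bd: "finite (bd C)" and bd_edges: "bd C \<subseteq> edges"
  unfolding bd_def using finite_edges by auto

lemma bd_continues:
  assumes "C \<in> \<F>" "{a, b} \<in> bd C" "d b \<ge> 2"
  obtains c where "c \<in> N b" "c \<noteq> a" "{b, c} \<in> bd C"
proof -
  have ab: "{a, b} \<in> edges" "pa.bounds {a, b} C" using assms(2) unfolding bd_def by auto
  have a: "a \<in> N b" "b \<in> V" using ab(1) edge_memI[of b a] N_D[of b a] edge_memI[of a b] by (auto simp: insert_commute)
  have "\<not> N b \<subseteq> {a}" using assms(3) card_mono[of "{a}" "N b"] by auto
  then obtain c' where c': "c' \<in> N b" "c' \<noteq> a" by auto
  have e': "{b, c'} \<in> edges" "{b, c'} \<noteq> {a, b}" using edgeI[OF a(2) c'(1)] c' by (auto simp: doubleton_eq_iff)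
  obtain e'' where e'': "e'' \<in> edges" "e'' \<noteq> {a, b}" "p b \<in> pa.ends e''" "pa.bounds e'' C"
    using pa.boundary_continues[OF assms(1) ab _ e', of "p b"] mem_ends a(2) ab(1) e'(1) by auto
  have "b \<in> e''" using mem_ends e'' a(2) by auto
  then obtain c where "c \<in> N b" "e'' = {b, c}" using edges_at[OF a(2)] e''(1) by auto
  thus ?thesis using that[of c] e'' unfolding bd_def by (auto simp: insert_commute)
qed

text \<open>The boundary graph has no vertex of degree 1, so the handshake lemma gives the
  inequality. It turns distinct vertices on a face into a lower bound for its charge.\<close>

lemma card_bd_ge_vertices:
  assumes C: "C \<in> \<F>" and deg2: "\<And>v. v \<in> V \<Longrightarrow> d v \<ge> 2"
  shows "card (\<Union>(bd C)) \<le> card (bd C)"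
proof -
  have sub: "\<Union>(bd C) \<subseteq> V" using bd_edges card_edge by blast
  have finU: "finite (\<Union>(bd C))" using sub finV by (rule finite_subset)
  have two: "2 \<le> card {e \<in> bd C. b \<in> e}" if bU: "b \<in> \<Union>(bd C)" for b
  proof -
    obtain e where e: "e \<in> bd C" "b \<in> e" using bU by blast
    have bV: "b \<in> V" using bU sub by blast
    have "e \<in> edges" using e(1) bd_edges by blast
    hence "e \<in> (\<lambda>u. {b, u}) ` N b" using edges_at[OF bV] e(2) by blast
    then obtain a where a: "e = {b, a}" "a \<in> N b" by blast
    have "{a, b} \<in> bd C" using e a by (simp add: insert_commute)
    then obtain c where c: "c \<in> N b" "c \<noteq> a" "{b, c} \<in> bd C" using bd_continues[OF C] deg2[OF bV] by blast
    have "{{b, a}, {b, c}} \<subseteq> {e \<in> bd C. b \<in> e}" using e a c by auto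
    hence "card {{b, a}, {b, c}} \<le> card {e \<in> bd C. b \<in> e}" using finite_bd by (intro card_mono) auto
    moreover have "{b, a} \<noteq> {b, c}" using c(2) by (auto simp: doubleton_eq_iff)
    ultimately show ?thesis by simp
  qed
  have "2 * card (\<Union>(bd C)) = (\<Sum>b\<in>\<Union>(bd C). 2)" by simp
  also have "\<dots> \<le> (\<Sum>b\<in>\<Union>(bd C). card {e \<in> bd C. b \<in> e})" using two by (intro sum_mono) auto
  also have "\<dots> = 2 * card (bd C)"
    using bd_edges card_edge by (intro sum_card_incident[OF finU finite_bd]) auto
  finally show ?thesis by simp
qed

lemma common_face:
  assumes v: "v \<in> V" "d v = 3" and w: "w1 \<in> N v" "w2 \<in> N v" "w1 \<noteq> w2"
  shows "\<exists>C\<in>\<F>. {v, w1} \<in> bd C \<and> {v, w2} \<in> bd C"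
proof -
  have "card (N v - {w1, w2}) = 1" using w v finN by (simp add: card_Diff_subset)
  then obtain w3 where w3: "N v - {w1, w2} = {w3}" by (auto simp: card_1_singleton_iff)
  hence Nv: "N v = {w1, w2, w3}" "w3 \<noteq> w1" "w3 \<noteq> w2" using w by auto
  have "{e \<in> edges. p v \<in> pa.ends e} = {e \<in> edges. v \<in> e}" using mem_ends v(1) by auto
  also have "\<dots> = {{v, w1}, {v, w2}, {v, w3}}" unfolding edges_at[OF v(1)] Nv(1) by auto
  finally have inc: "{e \<in> edges. p v \<in> pa.ends e} = {{v, w1}, {v, w2}, {v, w3}}" .
  have "\<exists>C\<in>\<F>. pa.bounds {v, w1} C \<and> pa.bounds {v, w2} C"
    by (rule pa.common_face_at_degree_three[OF _ inc])
       (use v w(3) Nv(2,3) in \<open>auto simp: doubleton_eq_iff\<close>)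
  thus ?thesis unfolding bd_def using edgeI[OF v(1)] w by blast
qed

lemma sum_bd: "(\<Sum>C\<in>\<F>. card (bd C)) \<le> 2 * card edges"
proof -
  have finF: "finite \<F>" by (rule pa.finite_faces) simp
  have "(\<Sum>C\<in>\<F>. card {e \<in> edges. pa.bounds e C}) = (\<Sum>e\<in>edges. card {C \<in> \<F>. pa.bounds e C})"
    by (rule sum_multicount_gen[OF finF finite_edges]) simp
  also have "\<dots> \<le> (\<Sum>e\<in>edges. 2)"
    by (rule sum_mono) (simp add: pa.card_bounded_faces)
  finally show ?thesis unfolding bd_def by simp
qed

text \<open>
  Discharging with initial charge \<open>d v - 4\<close> for vertices and \<open>card (bd C) - 4\<close> for faces. A vertex of degree at least 5
  sends 1/2 to each light neighbour, and a light vertex of degree 4 passes what it gets to its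
  unique neighbour of degree 3; the set \<open>Iv v\<close> lists the halves that reach \<open>v\<close>. The vertices of degree 3 that
  collect less than 1 form \<open>R\<close>. Such a vertex has two neighbours of degree 4 without another
  common neighbour, and it gets 1 from a face bounded by the two edges to them.
\<close>

lemma reducible:
  assumes ne: "V \<noteq> {}"
  shows "(\<exists>x\<in>V. d x \<le> 2) \<or> (\<exists>x\<in>V. \<exists>z\<in>N x. d x = 3 \<and> d z = 3) \<or>
      (\<exists>x\<in>V. d x \<ge> 4 \<and> d x \<le> card (N x \<inter> light V) + 2)"
proof (rule ccontr)
  assume "\<not> ?thesis"
  hence A1: "\<And>x. x \<in> V \<Longrightarrow> d x \<ge> 3"
    and A2: "\<And>x z. x \<in> V \<Longrightarrow> z \<in> N x \<Longrightarrow> d x = 3 \<Longrightarrow> d z \<noteq> 3"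
    and A3: "\<And>x. x \<in> V \<Longrightarrow> d x \<ge> 4 \<Longrightarrow> card (N x \<inter> light V) + 3 \<le> d x"
    by (force simp: not_le)+
  have deg2: "d v \<ge> 2" if "v \<in> V" for v using A1[OF that] by simp
  have light3: "v \<in> light V" if "v \<in> V" "d v = 3" for v using that unfolding light_def by auto
  have light4: "w \<in> light V" if "v \<in> V" "d v = 3" "w \<in> N v" "d w = 4" for v w
    using that N_D[OF that(3)] N_sym[OF that(1,3)] unfolding light_def by blast
  have uniq: "y = y'" if "w \<in> V" "d w = 4" "y \<in> N w" "y \<in> light V" "y' \<in> N w" "y' \<in> light V" for w y y'
  proof -
    have "card (N w \<inter> light V) \<le> 1" using A3[of w] that by simp
    thus ?thesis using that finN[of w] by (auto simp: card_le_Suc0_iff_eq)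
  qed
  define T where "T = {v \<in> V. d v = 3}"
  define Big where "Big = {x \<in> V. d x \<ge> 5}"
  \<comment> \<open>Halves are counted as pairs of sender and first receiver, which keeps the
    charges in the natural numbers.\<close>
  define I where "I = Sigma Big (\<lambda>x. N x \<inter> light V)"
  define Iv where "Iv v = {xy \<in> I. snd xy = v \<or> d (snd xy) = 4 \<and> v \<in> N (snd xy)}" for v
  define PQ where "PQ = {v \<in> T. card (Iv v) \<ge> 2}"
  define R where "R = T - PQ"
  have finB: "finite Big" and finT: "finite T" using finV unfolding Big_def T_def by auto
  have finI: "finite I" unfolding I_def using finB finN by auto
  have finIv: "finite (Iv v)" for v unfolding Iv_def using finI by auto
  have finR: "finite R" "finite PQ" "PQ \<subseteq> T" unfolding R_def PQ_def using finT by auto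
  \<comment> \<open>A half that is passed on has one destination, because a vertex of degree 4 has
    at most one light neighbour.\<close>
  have disj: "Iv v \<inter> Iv v' = {}" if v: "v \<in> T" "v' \<in> T" "v \<noteq> v'" for v v'
  proof (rule ccontr)
    assume "Iv v \<inter> Iv v' \<noteq> {}"
    then obtain z where z: "z \<in> Iv v" "z \<in> Iv v'" by blast
    obtain x y where zxy: "z = (x, y)" by (cases z)
    have xy: "(x, y) \<in> I" "y = v \<or> d y = 4 \<and> v \<in> N y" "y = v' \<or> d y = 4 \<and> v' \<in> N y"
      using z unfolding Iv_def zxy by simp_all
    have dT: "d v = 3" "d v' = 3" "v \<in> V" "v' \<in> V" using v unfolding T_def by auto
    have "d y = 4" "v \<in> N y" "v' \<in> N y" using xy v(3) dT by auto
    moreover have "y \<in> V" using xy(1) N_D unfolding I_def by auto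
    ultimately show False using uniq light3 dT v(3) by metis
  qed
  have cI: "card I \<le> (\<Sum>x\<in>Big. 2 * (d x - 4))"
  proof -
    have "card I = (\<Sum>x\<in>Big. card (N x \<inter> light V))" unfolding I_def using finB finN by (intro card_SigmaI) auto
    also have "\<dots> \<le> (\<Sum>x\<in>Big. 2 * (d x - 4))"
    proof (rule sum_mono)
      fix x assume "x \<in> Big"
      \<comment> \<open>At least three neighbours are not light, and
        \<open>d x - 3 \<le> 2 * (d x - 4)\<close> once \<open>d x \<ge> 5\<close>.\<close>
      thus "card (N x \<inter> light V) \<le> 2 * (d x - 4)" using A3[of x] unfolding Big_def by auto
    qed
    finally show ?thesis .
  qed
  have "2 * card PQ = (\<Sum>v\<in>PQ. 2)" by simp
  also have "\<dots> \<le> (\<Sum>v\<in>PQ. card (Iv v))" by (rule sum_mono) (simp add: PQ_def)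
  also have "\<dots> = card (\<Union>v\<in>PQ. Iv v)"
    using finR(2,3) finIv disj by (intro card_UN_disjoint[symmetric] ballI impI) blast+
  also have "\<dots> \<le> card I" using finI by (intro card_mono) (auto simp: Iv_def)
  finally have PQ: "card PQ \<le> (\<Sum>x\<in>Big. d x - 4)" using cI by (simp add: sum_distrib_left[symmetric])
  have pair: "False" if "v \<in> R" "a \<in> Iv v" "b \<in> Iv v" "a \<noteq> b" for v a b
  proof -
    have "card {a, b} \<le> card (Iv v)" using that finIv by (intro card_mono) auto
    thus False using that unfolding R_def PQ_def by auto
  qed
  have choice: "\<exists>w1 w2 C. w1 \<in> N v \<and> w2 \<in> N v \<and> w1 \<noteq> w2 \<and> d w1 = 4 \<and> d w2 = 4 \<and>
      N w1 \<inter> N w2 \<subseteq> {v} \<and> C \<in> \<F> \<and> {v, w1} \<in> bd C \<and> {v, w2} \<in> bd C" if vR: "v \<in> R" for v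
  proof -
    have v: "v \<in> V" "d v = 3" using vR unfolding R_def T_def by auto
    have Nd: "d w = 4 \<or> w \<in> Big" if "w \<in> N v" for w
      using that N_D[OF that] A1[of w] A2[OF v(1) that v(2)] unfolding Big_def by auto
    have inIv: "(x, v) \<in> Iv v" if "x \<in> N v" "x \<in> Big" for x
      using that light3[OF v] N_sym[OF v(1) that(1)] unfolding Iv_def I_def by auto
    \<comment> \<open>Each neighbour in \<open>Big\<close> sends a half directly to
      \<open>v\<close>, and \<open>v\<close> collects fewer than two.\<close>
    have "card (N v \<inter> Big) \<le> 1"
    proof -
      have "x = y" if "x \<in> N v \<inter> Big" "y \<in> N v \<inter> Big" for x y
        using pair[OF vR inIv inIv, of x y] that by blast
      thus ?thesis using finN[of v] by (auto simp: card_le_Suc0_iff_eq)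
    qed
    moreover have "card (N v) = card (N v \<inter> Big) + card (N v - Big)"
      using finN[of v] card_Int_Diff by blast
    ultimately have "2 \<le> card (N v - Big)" using v(2) by simp
    then obtain w1 w2 where w: "w1 \<in> N v - Big" "w2 \<in> N v - Big" "w1 \<noteq> w2"
      using card_2_iff' ex_card[of 2 "N v - Big"] by (metis subsetD)
    have w4: "d w1 = 4" "d w2 = 4" "w1 \<in> N v" "w2 \<in> N v" using w Nd by auto
    have wV: "w1 \<in> V" "w2 \<in> V" "v \<in> N w1" "v \<in> N w2" using N_D[OF w4(3)] N_D[OF w4(4)] N_sym[OF v(1)] w4 by auto
    have wl: "w1 \<in> light V" "w2 \<in> light V" using light4[OF v] w4 by auto
    \<comment> \<open>Another common neighbour \<open>x\<close> cannot have degree 3, being a second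
      light neighbour of \<open>w1\<close>, nor degree 4, having two light neighbours. So it is in
      \<open>Big\<close>, and its halves to \<open>w1\<close> and \<open>w2\<close> both reach
      \<open>v\<close>.\<close>
    have "x = v" if x: "x \<in> N w1" "x \<in> N w2" for x
    proof (rule ccontr)
      assume "x \<noteq> v"
      have xV: "x \<in> V" "w1 \<in> N x" "w2 \<in> N x" using N_D[OF x(1)] N_sym[OF wV(1) x(1)] N_sym[OF wV(2) x(2)] by auto
      have "d x \<noteq> 3"
        using uniq[OF wV(1) w4(1) x(1) light3[OF xV(1)] wV(3) light3[OF v]] \<open>x \<noteq> v\<close> by auto
      moreover have "d x \<noteq> 4" using uniq[OF xV(1) _ xV(2) wl(1) xV(3) wl(2)] w(3) by auto
      ultimately have "x \<in> Big" using A1[OF xV(1)] xV(1) unfolding Big_def by auto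
      hence "(x, w1) \<in> Iv v" "(x, w2) \<in> Iv v"
        using xV wl w4 wV unfolding Iv_def I_def by auto
      thus False using pair[OF vR] w(3) by blast
    qed
    moreover obtain C where "C \<in> \<F>" "{v, w1} \<in> bd C" "{v, w2} \<in> bd C"
      using common_face[OF v w4(3,4) w(3)] by auto
    ultimately show ?thesis using w4 w(3) by blast
  qed
  then obtain w1 w2 F where F: "\<And>v. v \<in> R \<Longrightarrow> w1 v \<in> N v \<and> w2 v \<in> N v \<and> w1 v \<noteq> w2 v \<and> d (w1 v) = 4 \<and> d (w2 v) = 4 \<and>
      N (w1 v) \<inter> N (w2 v) \<subseteq> {v} \<and> F v \<in> \<F> \<and> {v, w1 v} \<in> bd (F v) \<and> {v, w2 v} \<in> bd (F v)"
    by metis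
  have face: "4 + card {v \<in> R. F v = C} \<le> card (bd C)" if C: "C \<in> \<F>" for C
  proof -
    define RC where "RC = {v \<in> R. F v = C}"
    have finU: "finite (\<Union>(bd C))" using finite_bd bd_edges finV card_edge by (meson Union_least finite_subset subset_iff)
    have vert: "card X \<le> card (bd C)" if "X \<subseteq> \<Union>(bd C)" for X
      using card_mono[OF finU that] card_bd_ge_vertices[OF C deg2] by simp
    have finRC: "finite RC" unfolding RC_def using finR by auto
    have next_edge: "\<exists>c. c \<in> N b \<and> c \<noteq> a \<and> {b, c} \<in> bd C" if "{a, b} \<in> bd C" for a b
    proof -
      have "b \<in> V" using that bd_edges card_edge by blast
      thus ?thesis using bd_continues[OF C that] deg2 by metis
    qed
    have V3: "v \<in> V" "d v = 3" if "v \<in> R" for v using that unfolding R_def T_def by auto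
    consider "RC = {}" | v where "RC = {v}" | "card RC \<ge> 2"
    proof -
      assume *: "RC = {} \<Longrightarrow> thesis" "\<And>v. RC = {v} \<Longrightarrow> thesis" "2 \<le> card RC \<Longrightarrow> thesis"
      have "card RC = 0 \<or> card RC = 1 \<or> 2 \<le> card RC" by linarith
      thus thesis using * finRC by (auto simp: card_1_singleton_iff)
    qed
    \<comment> \<open>Distinct vertices on the face are exhibited: 4 if \<open>RC\<close> is empty,
      5 if it has one element, and otherwise 3 for each element, where
      \<open>3 * k \<ge> k + 4\<close> for \<open>k \<ge> 2\<close>.\<close>
    hence "4 + card RC \<le> card (bd C)"
    proof cases
      case 1
      obtain v where v: "v \<in> V" using ne by auto
      have "N v \<noteq> {}" using A1[OF v] by auto
      hence "edges \<noteq> {}" using edgeI[OF v] by blast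
      then obtain e where e: "e \<in> edges" "e \<in> bd C" using pa.face_has_boundary[OF C] unfolding bd_def by auto
      obtain a b where ab: "e = {a, b}" "b \<in> N a" using e(1) by (rule edgesE)
      obtain c where c: "c \<in> N b" "c \<noteq> a" "{b, c} \<in> bd C" using next_edge e ab by blast
      obtain x where x: "x \<in> N c" "x \<noteq> b" "{c, x} \<in> bd C" using next_edge c by blast
      have "x \<noteq> a" "a \<noteq> b" "b \<noteq> c" "c \<noteq> x" using tri N_D[OF ab(2)] N_D[OF c(1)] N_D[OF x(1)] by auto
      hence "card {a, b, c, x} = 4" using c x by auto
      moreover have "{a, b, c, x} \<subseteq> \<Union>(bd C)" using e ab c x by auto
      ultimately show ?thesis using vert[of "{a, b, c, x}"] 1 by simp
    next
      case 2
      hence vR: "v \<in> R" "F v = C" unfolding RC_def by auto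
      note w = F[OF vR(1), unfolded vR(2)]
      have "{v, w1 v} \<in> bd C" "{v, w2 v} \<in> bd C" using w by auto
      then obtain a b where a: "a \<in> N (w1 v)" "a \<noteq> v" "{w1 v, a} \<in> bd C"
        and b: "b \<in> N (w2 v)" "b \<noteq> v" "{w2 v, b} \<in> bd C" using next_edge by meson
      have nd: "w1 v \<in> N v" "w2 v \<in> N v" using w by auto
      \<comment> \<open>The neighbours \<open>w1 v\<close> and \<open>w2 v\<close> of
        \<open>v\<close> are not adjacent, as this would be a triangle. That \<open>a\<close> and
        \<open>b\<close> differ rests on \<open>v\<close> being their only common neighbour.\<close>
      have "a \<noteq> w2 v" "b \<noteq> w1 v" "a \<noteq> w1 v" "b \<noteq> w2 v" "w1 v \<noteq> v" "w2 v \<noteq> v"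
        using tri N_D[OF nd(1)] N_D[OF nd(2)] N_D[OF a(1)] N_D[OF b(1)] by auto
      moreover have "a \<noteq> b" using w a b by auto
      ultimately have "card {v, w1 v, w2 v, a, b} = 5" using w a(2) b(2) by auto
      moreover have "{v, w1 v, w2 v, a, b} \<subseteq> \<Union>(bd C)" using w a b by auto
      ultimately show ?thesis using vert[of "{v, w1 v, w2 v, a, b}"] 2 by simp
    next
      case 3
      define X where "X v = {v, w1 v, w2 v}" for v
      have w: "w1 v \<in> N v" "w2 v \<in> N v" "w1 v \<noteq> w2 v" "d (w1 v) = 4" "d (w2 v) = 4" "v \<in> V" "d v = 3"
        "{v, w1 v} \<in> bd C" "{v, w2 v} \<in> bd C" if "v \<in> RC" for v
        using that F V3 unfolding RC_def by auto
      have cX: "card (X v) = 3" if "v \<in> RC" for v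
        using w[OF that] N_D[of "w1 v" v] N_D[of "w2 v" v] unfolding X_def by auto
      have shared: "v = v'" if v: "v \<in> RC" "v' \<in> RC" and u: "u \<in> N v" "u \<in> N v'" "d u = 4" for v v' u
      proof -
        have "u \<in> V" "v \<in> N u" "v' \<in> N u" using N_D[OF u(1)] N_sym[OF w(6)[OF v(1)] u(1)] N_sym[OF w(6)[OF v(2)] u(2)] by auto
        thus ?thesis using uniq u(3) light3 w(6,7) v by metis
      qed
      \<comment> \<open>Degrees tell the centre of a triple from its other two vertices, and a
        vertex of degree 4 in two triples would have two light neighbours.\<close>
      have dX: "X v \<inter> X v' = {}" if v: "v \<in> RC" "v' \<in> RC" "v \<noteq> v'" for v v'
      proof (rule ccontr)
        assume "X v \<inter> X v' \<noteq> {}"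
        then obtain u where u: "u \<in> X v" "u \<in> X v'" by auto
        show False
        proof (cases "d u = 3")
          case True
          thus ?thesis using u w[OF v(1)] w[OF v(2)] v(3) unfolding X_def by auto
        next
          case False
          hence "u \<in> N v" "u \<in> N v'" "d u = 4" using u w[OF v(1)] w[OF v(2)] unfolding X_def by auto
          thus ?thesis using shared v by blast
        qed
      qed
      have "card (\<Union>v\<in>RC. X v) = (\<Sum>v\<in>RC. card (X v))"
        by (rule card_UN_disjoint[OF finRC]) (use dX in \<open>simp_all add: X_def\<close>)
      hence "card (\<Union>v\<in>RC. X v) = 3 * card RC" using cX by simp
      moreover have "(\<Union>v\<in>RC. X v) \<subseteq> \<Union>(bd C)" using w(8,9) unfolding X_def by blast
      ultimately show ?thesis using vert[of "\<Union>v\<in>RC. X v"] 3 by linarith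
    qed
    thus ?thesis unfolding RC_def .
  qed
  have finF: "finite \<F>" by (rule pa.finite_faces) simp
  have Rsum: "card R = (\<Sum>C\<in>\<F>. card {v \<in> R. F v = C})"
  proof -
    have "R = (\<Union>C\<in>\<F>. {v \<in> R. F v = C})" using F by auto
    also have "card \<dots> = (\<Sum>C\<in>\<F>. card {v \<in> R. F v = C})"
      using finF finR by (intro card_UN_disjoint) auto
    finally show ?thesis .
  qed
  have "4 * card \<F> + card R = (\<Sum>C\<in>\<F>. 4 + card {v \<in> R. F v = C})"
    unfolding Rsum by (simp add: sum.distrib)
  also have "\<dots> \<le> (\<Sum>C\<in>\<F>. card (bd C))" using face by (rule sum_mono)
  also have "\<dots> \<le> 2 * card edges" by (rule sum_bd)
  finally have S1: "4 * card \<F> + card R \<le> 2 * card edges" .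
  \<comment> \<open>The sum of the vertex charges without negative terms: each vertex of
    \<open>T\<close> has charge -1, moved to the right.\<close>
  have "4 * card V + (\<Sum>x\<in>Big. d x - 4) \<le> 2 * card edges + card T"
  proof -
    have eq: "(\<Sum>x\<in>Big. d x - 4) = (\<Sum>x\<in>V. if x \<in> Big then d x - 4 else 0)"
      "card T = (\<Sum>x\<in>V. if x \<in> T then 1 else 0)"
      using finV by (simp_all add: sum.If_cases Big_def T_def Int_def conj_commute)
    have "4 * card V + (\<Sum>x\<in>Big. d x - 4) = (\<Sum>x\<in>V. 4 + (if x \<in> Big then d x - 4 else 0))"
      unfolding eq sum.distrib by simp
    also have "\<dots> \<le> (\<Sum>x\<in>V. d x + (if x \<in> T then 1 else 0))"
    proof (rule sum_mono)
      fix x assume x: "x \<in> V"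
      show "4 + (if x \<in> Big then d x - 4 else 0) \<le> d x + (if x \<in> T then 1 else 0)"
        using A1[OF x] x unfolding Big_def T_def by auto
    qed
    also have "\<dots> = 2 * card edges + card T" unfolding sum.distrib eq(2) sum_d ..
    finally show ?thesis .
  qed
  moreover have "card R + card PQ = card T"
    unfolding R_def using finR finT by (simp add: card_Diff_subset card_mono)
  ultimately have S2: "4 * card V \<le> 2 * card edges + card R" using PQ by linarith
  \<comment> \<open>In the sum of \<open>S1\<close> and \<open>S2\<close> the term
    \<open>card R\<close> cancels, leaving
    \<open>card \<F> + card V \<le> card edges\<close>.\<close>
  have "card \<F> + card V \<ge> card edges + 2"
    using pa.Euler_lower_bound ne card_image[OF inj] by simp
  thus False using S1 S2 by linarith
qed

end

section \<open>Sequences of colorings\<close>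

fun colorings_along :: "('a \<Rightarrow> 'c) \<Rightarrow> ('a \<times> 'c) list \<Rightarrow> ('a \<Rightarrow> 'c) list" where
  "colorings_along \<phi> [] = [\<phi>]"
| "colorings_along \<phi> ((v, c) # ms) = \<phi> # colorings_along (\<phi>(v := c)) ms"

lemma colorings_along_Cons: "\<exists>\<psi>s. colorings_along \<phi> ms = \<phi> # \<psi>s"
  by (cases ms) auto

lemma hd_colorings_along [simp]: "hd (colorings_along \<phi> ms) = \<phi>"
  and colorings_along_nonempty [simp]: "colorings_along \<phi> ms \<noteq> []"
  using colorings_along_Cons[of \<phi> ms] by auto

lemma times_recolored_Cons:
  "times_recolored (\<phi> # \<psi> # \<psi>s) v = (if \<phi> v = \<psi> v then 0 else 1) + times_recolored (\<psi> # \<psi>s) v"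
proof -
  let ?A = "{i. Suc i < length (\<psi> # \<psi>s) \<and> ((\<psi> # \<psi>s) ! i) v \<noteq> ((\<psi> # \<psi>s) ! Suc i) v}"
  let ?Z = "if \<phi> v = \<psi> v then {} else {0::nat}"
  have "{i. Suc i < length (\<phi> # \<psi> # \<psi>s) \<and> ((\<phi> # \<psi> # \<psi>s) ! i) v \<noteq> ((\<phi> # \<psi> # \<psi>s) ! Suc i) v} = ?Z \<union> Suc ` ?A"
    (is "?B = _")
  proof (rule set_eqI)
    fix i show "i \<in> ?B \<longleftrightarrow> i \<in> ?Z \<union> Suc ` ?A" by (cases i) auto
  qed
  moreover have "finite ?A" by simp
  moreover have "?Z \<inter> Suc ` ?A = {}" by auto
  ultimately show ?thesis
    unfolding times_recolored_def by (simp add: card_Un_disjoint card_image)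
qed

context list_graph
begin

lemma last_colorings_along: "last (colorings_along \<phi> ms) = run \<phi> ms"
  by (induction ms arbitrary: \<phi>) auto

lemma times_recolored_along:
  "valid W \<phi> ms \<Longrightarrow> times_recolored (colorings_along \<phi> ms) v = moves_of v ms"
proof (induction ms arbitrary: \<phi>)
  case Nil show ?case by (simp add: times_recolored_def)
next
  case (Cons m ms)
  obtain u c where m: "m = (u, c)" by (cases m)
  obtain \<psi>s where \<psi>s: "colorings_along (\<phi>(u := c)) ms = \<phi>(u := c) # \<psi>s"
    using colorings_along_Cons by blast
  have "valid W (\<phi>(u := c)) ms" "c \<noteq> \<phi> u" using Cons.prems unfolding m by simp_all
  from Cons.IH[OF this(1)] this(2) show ?case
    unfolding m colorings_along.simps \<psi>s times_recolored_Cons moves_of_simps by auto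
qed

end

lemma pair_graph_fin_graph:
  assumes "pair_graph G"
  shows "fin_graph (pverts G) (\<lambda>u v. (u, v) \<in> parcs G)"
proof -
  interpret pair_graph G by fact
  show ?thesis
  proof
    show "finite (pverts G)" by (rule pair_finite_verts)
    show "(v, u) \<in> parcs G" if "(u, v) \<in> parcs G" for u v
      using pair_sym_arcs that by (simp add: symmetric_def sym_def)
    show "(v, v) \<notin> parcs G" for v using pair_no_loops[of "(v, v)"] by auto
  qed
qed

lemma L_coloring_iff:
  assumes "pair_graph G"
  shows "L_coloring G L \<phi> \<longleftrightarrow>
    \<phi> \<in> extensional (pverts G) \<and> list_graph.coloring (\<lambda>u v. (u, v) \<in> parcs G) L (pverts G) \<phi>"
proof -
  interpret pair_graph G by fact
  interpret list_graph "pverts G" "\<lambda>u v. (u, v) \<in> parcs G" L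
    by (rule list_graph.intro[OF pair_graph_fin_graph[OF \<open>pair_graph G\<close>]])
  show ?thesis unfolding L_coloring_def coloring_def
    by (auto simp: PiE_iff dest: in_arcsD1 in_arcsD2)
qed

lemma L_recoloring_sequence_along:
  assumes G: "pair_graph G" and \<phi>: "L_coloring G L \<phi>"
    and val: "list_graph.valid (\<lambda>u v. (u, v) \<in> parcs G) L (pverts G) \<phi> ms"
  shows "L_recoloring_sequence G L (colorings_along \<phi> ms)"
proof -
  interpret pair_graph G by fact
  interpret list_graph "pverts G" "\<lambda>u v. (u, v) \<in> parcs G" L
    by (rule list_graph.intro[OF pair_graph_fin_graph[OF \<open>pair_graph G\<close>]])
  have "successively (L_recoloring_step G L) (colorings_along \<phi> ms)"
    using \<phi> val
  proof (induction ms arbitrary: \<phi>)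
    case (Cons m ms)
    obtain v c where m: "m = (v, c)" by (cases m)
    note prems = Cons.prems(2)[unfolded m valid.simps]
    have col: "L_coloring G L (\<phi>(v := c))"
      using Cons.prems(1) prems coloring_upd[of "pverts G" \<phi> v c]
      unfolding L_coloring_iff[OF G] by (auto simp: extensional_def)
    have "L_recoloring_step G L \<phi> (\<phi>(v := c))"
      unfolding L_recoloring_step_def using Cons.prems(1) col prems by blast
    moreover have "successively (L_recoloring_step G L) (colorings_along (\<phi>(v := c)) ms)"
      using Cons.IH[OF col] prems by blast
    ultimately show ?case unfolding m colorings_along.simps
      by (simp add: successively_Cons)
  qed simp
  thus ?thesis unfolding L_recoloring_sequence_def using \<phi> by simp
qed

theorem theorem2:
  fixes G :: "'a pair_pre_digraph"
    and L :: "'a \<Rightarrow> 'c set"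
    and \<alpha> \<beta> :: "'a \<Rightarrow> 'c"
  assumes "pair_graph G"
    and "triangle_free G"
    and "planar G"
    and "k_assignment G 7 L"
    and "L_coloring G L \<alpha>"
    and "L_coloring G L \<beta>"
  shows "\<exists>\<sigma>. L_recoloring_sequence G L \<sigma> \<and> transforms \<sigma> \<alpha> \<beta> \<and>
           (\<forall>v \<in> pverts G. times_recolored \<sigma> v \<le> 30)"
proof -
  interpret pair_graph G by fact
  let ?adj = "\<lambda>u v. (u, v) \<in> parcs G"
  interpret list7_graph "pverts G" ?adj L
  proof (intro list7_graph.intro list_graph.intro list7_graph_axioms.intro)
    show "fin_graph (pverts G) ?adj" by (rule pair_graph_fin_graph[OF assms(1)])
    show "card (L v) = 7" if "v \<in> pverts G" for v
      using assms(4) that unfolding k_assignment_def by blast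
  qed
  obtain p \<gamma> where pd: "plane_drawing G p \<gamma>" using assms(3) unfolding planar_def by blast
  note pd' = pd[unfolded plane_drawing_def]
  note pd_arc = conjunct1[OF conjunct2[OF pd'], rule_format]
  note pd_cross = conjunct2[OF conjunct2[OF pd'], rule_format]
  have red: "(\<exists>x\<in>W. deg W x \<le> 2) \<or> (\<exists>x\<in>W. \<exists>z\<in>nb W x. deg W x = 3 \<and> deg W z = 3) \<or>
      (\<exists>x\<in>W. deg W x \<ge> 4 \<and> deg W x \<le> card (nb W x \<inter> light W) + 2)"
    if W: "W \<subseteq> pverts G" "W \<noteq> {}" for W
  proof -
    interpret W: planar_graph W ?adj p \<gamma>
    proof
      show "finite W" using W(1) pair_finite_verts by (rule finite_subset)
      show "\<not> ?adj w u" if "?adj u v" "?adj v w" for u v w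
        using assms(2) that unfolding triangle_free_def by blast
      show "inj_on p W" using inj_on_subset[OF conjunct1[OF pd'] W(1)] .
    next
      fix u v assume uv: "u \<in> W" "v \<in> W" "?adj u v"
      show "Path_Connected.arc (\<gamma> {u, v})" "{pathstart (\<gamma> {u, v}), pathfinish (\<gamma> {u, v})} = {p u, p v}"
        using pd_arc[OF uv(3)] by simp_all
      have "path_image (\<gamma> {u, v}) \<inter> p ` pverts G = {p u, p v}" using pd_arc[OF uv(3)] by simp
      thus "path_image (\<gamma> {u, v}) \<inter> p ` W = {p u, p v}" using uv(1,2) W(1) by blast
      fix x y assume xy: "x \<in> W" "y \<in> W" "?adj x y" "{u, v} \<noteq> {x, y}"
      have "path_image (\<gamma> {u, v}) \<inter> path_image (\<gamma> {x, y}) \<subseteq> p ` ({u, v} \<inter> {x, y})"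
        by (rule pd_cross[OF uv(3) xy(3,4)])
      also have "\<dots> \<subseteq> p ` W" using uv(1,2) by blast
      finally show "path_image (\<gamma> {u, v}) \<inter> path_image (\<gamma> {x, y}) \<subseteq> p ` W" .
    qed (use adj_sym adj_irrefl in auto)
    show ?thesis using W.reducible[OF W(2)] .
  qed
  have "good (pverts G) (\<lambda>_. 30)" by (rule good_if_reducible[OF red]) auto
  moreover have \<alpha>: "coloring (pverts G) \<alpha>" and \<beta>: "coloring (pverts G) \<beta>"
    using assms(5,6) L_coloring_iff[OF assms(1)] by auto
  ultimately obtain ms where ms: "valid (pverts G) \<alpha> ms"
      "\<And>v. v \<in> pverts G \<Longrightarrow> run \<alpha> ms v = \<beta> v \<and> moves_of v ms \<le> 30"
    unfolding good_def by blast
  define \<sigma> where "\<sigma> = colorings_along \<alpha> ms"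
  have seq: "L_recoloring_sequence G L \<sigma>"
    unfolding \<sigma>_def by (rule L_recoloring_sequence_along[OF assms(1,5) ms(1)])
  \<comment> \<open>The final coloring must equal \<open>\<beta>\<close> as a function. Off the
    vertex set no move acts, and both colorings are \<open>undefined\<close> there.\<close>
  have "run \<alpha> ms v = \<beta> v" for v
  proof (cases "v \<in> pverts G")
    case False
    have "run \<alpha> ms v = \<alpha> v" using ms(1) False
    proof (induction ms arbitrary: \<alpha>)
      case (Cons m ms)
      obtain u c where m: "m = (u, c)" by (cases m)
      have "run (\<alpha>(u := c)) ms v = (\<alpha>(u := c)) v"
        by (rule Cons.IH) (use Cons.prems(1)[unfolded m valid.simps] Cons.prems(2) in blast)+
      moreover have "u \<noteq> v" using Cons.prems m by auto
      ultimately show ?case unfolding m run.simps by simp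
    qed simp
    thus ?thesis using False assms(5,6) unfolding L_coloring_iff[OF assms(1)] by (simp add: extensional_def)
  qed (use ms in auto)
  hence "transforms \<sigma> \<alpha> \<beta>" unfolding transforms_def \<sigma>_def last_colorings_along by auto
  moreover have "times_recolored \<sigma> v \<le> 30" if "v \<in> pverts G" for v
    unfolding \<sigma>_def using times_recolored_along[OF ms(1)] ms(2)[OF that] by simp
  ultimately show ?thesis using seq by blast
qed

end
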